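(* Let $S_j$ be local potentials satisfying (A)–(E), let $\Psi_t$ be the flow of $\frac{dx}{dt}=-\nabla W(x)$ on $\mathbb{X}$, let $t>0$ and let $K\subset\mathbb{R}^d$ be compact. For every $n\in\mathbb{N}\cup\{0\}$ there is a constant $L>0$ depending only on $K$, $n$ and $t$ (and the potentials) such that for all Birkhoff configurations $x<y$ with rotation vectors in $K$ and all $i,k\in\mathbb{Z}^d$ with $\|i-k\|=n$, $$(\Psi_ty)_i-(\Psi_tx)_i\ge L\,(y_k-x_k).$$
   Context: Notation: $\|i\|=\sum_{k=1}^d|i_k|$, $B_j^r=\{k:\|k-j\|\le r\}$, $(\tau_{k,l}x)_i=x_{i+k}+l$. Local potentials $S_j:\mathbb{R}^{\mathbb{Z}^d}\to\mathbb{R}$, $j\in\mathbb{Z}^d$, satisfy: (A) there is $r\in(0,\infty)$ and $C^2$ functions $s_j:\mathbb{R}^{B_j^r}\to\mathbb{R}$ with $S_j(x)=s_j(x|_{B_j^r})$; (B) $S_j(\tau_{k,l}x)=S_{j+k}(x)$; (C) each $S_j$ is bounded below and $S_j(x)\to\infty$ as $|x_k-x_j|\to\infty$ whenever $\|k-j\|=1$; (D) $\partial_{i,k}S_j\le0$ for $i\ne k$, and $\partial_{i,k}S_i<0$ when $\|i-k\|=1$; (E) $|\partial_{i,k}S_j|\le C$ uniformly. $\mathbb{X}=\{x:\sum_i2^{-\|i\|}|x_i|<\infty\}$; $(\nabla W(x))_i=\sum_{\|j-i\|\le r}\partial_iS_j(x)$; $\Psi_t$ is the complete flow of $\dot x=-\nabla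 W(x)$ on $\mathbb{X}$ (which contains all Birkhoff configurations). Order: $x<y$ iff $x_i\le y_i$ for all $i$ and $x\ne y$. Birkhoff: for every $(k,l)$, $\tau_{k,l}x\ge x$ or $\tau_{k,l}x\le x$; rotation vector $\omega$: $\lim_nx_{ni}/n=\langle\omega,i\rangle$ for all $i$. *)

theory Defs
  imports "HOL-Analysis.Analysis"
begin

type_synonym 'd config = "int^'d \<Rightarrow> real"

definition norm1 :: "int^('d::finite) \<Rightarrow> int" where
  "norm1 i = (\<Sum>m\<in>UNIV. \<bar>i $ m\<bar>)"

definition lball :: "int^('d::finite) \<Rightarrow> real \<Rightarrow> (int^'d) set" where
  "lball j r = {k. real_of_int (norm1 (k - j)) \<le> r}"

definition shift :: "int^('d::finite) \<Rightarrow> int \<Rightarrow> 'd config \<Rightarrow> 'd config" where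
  "shift k l x = (\<lambda>i. x (i + k) + real_of_int l)"

definition pdiff_exists :: "int^('d::finite) \<Rightarrow> ('d config \<Rightarrow> real) \<Rightarrow> bool" where
  "pdiff_exists i f \<longleftrightarrow> (\<forall>x. (\<lambda>h. f (x(i := x i + h))) differentiable (at 0))"

definition pdiff :: "int^('d::finite) \<Rightarrow> ('d config \<Rightarrow> real) \<Rightarrow> 'd config \<Rightarrow> real" where
  "pdiff i f x = deriv (\<lambda>h. f (x(i := x i + h))) 0"

text \<open>(A): S j depends only on the coordinates in B_j^r, via a C^2 function s_j
  on the finite-dimensional space R^{B_j^r}. C^2 is expressed by: all first and second
  partial derivatives exist and are continuous (product topology, which on functions of
  finitely many coordinates is the Euclidean topology of R^{B_j^r}).\<close>
definition C2_fun :: "(('d::finite) config \<Rightarrow> real) \<Rightarrow> bool" where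
  "C2_fun f \<longleftrightarrow> continuous_on UNIV f \<and>
     (\<forall>i. pdiff_exists i f \<and> continuous_on UNIV (pdiff i f) \<and>
       (\<forall>k. pdiff_exists k (pdiff i f) \<and> continuous_on UNIV (pdiff k (pdiff i f))))"

definition local_potentials :: "(int^('d::finite) \<Rightarrow> 'd config \<Rightarrow> real) \<Rightarrow> real \<Rightarrow> bool" where
  "local_potentials S r \<longleftrightarrow>
     0 < r \<and>
     \<comment> \<open>(A)\<close>
     (\<forall>j x y. (\<forall>k\<in>lball j r. x k = y k) \<longrightarrow> S j x = S j y) \<and>
     (\<forall>j. C2_fun (S j)) \<and>
     \<comment> \<open>(B)\<close>
     (\<forall>j k l x. S j (shift k l x) = S (j + k) x) \<and>
     \<comment> \<open>(C)\<close>
     (\<forall>j. \<exists>c. \<forall>x. c \<le> S j x) \<and>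
     (\<forall>j k. norm1 (k - j) = 1 \<longrightarrow>
        (\<forall>M. \<exists>R. \<forall>x. R < \<bar>x k - x j\<bar> \<longrightarrow> M < S j x)) \<and>
     \<comment> \<open>(D)\<close>
     (\<forall>i k j x. i \<noteq> k \<longrightarrow> pdiff i (pdiff k (S j)) x \<le> 0) \<and>
     (\<forall>i k x. norm1 (i - k) = 1 \<longrightarrow> pdiff i (pdiff k (S i)) x < 0) \<and>
     \<comment> \<open>(E)\<close>
     (\<exists>C. \<forall>i k j x. \<bar>pdiff i (pdiff k (S j)) x\<bar> \<le> C)"

definition gradW :: "(int^('d::finite) \<Rightarrow> 'd config \<Rightarrow> real) \<Rightarrow> real \<Rightarrow> 'd config \<Rightarrow> 'd config" where
  "gradW S r x = (\<lambda>i. \<Sum>j\<in>lball i r. pdiff i (S j) x)"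

definition Xspace :: "('d::finite) config set" where
  "Xspace = {x. (\<lambda>i. 2 powr (- real_of_int (norm1 i)) * \<bar>x i\<bar>) summable_on UNIV}"

definition normX :: "('d::finite) config \<Rightarrow> real" where
  "normX x = (\<Sum>\<^sub>\<infinity>i. 2 powr (- real_of_int (norm1 i)) * \<bar>x i\<bar>)"

definition is_gradient_flow ::
  "(int^'d \<Rightarrow> 'd config \<Rightarrow> real) \<Rightarrow> real \<Rightarrow> (real \<Rightarrow> 'd config \<Rightarrow> 'd config) \<Rightarrow> bool" where
  "is_gradient_flow S r Psi \<longleftrightarrow>
     (\<forall>x\<in>Xspace. Psi 0 x = x \<and>
        (\<forall>t. Psi t x \<in> Xspace \<and>
           ((\<lambda>h. normX (\<lambda>i. (Psi (t + h) x i - Psi t x i) / h + gradW S r (Psi t x) i))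
              \<longlongrightarrow> 0) (at 0)))"

definition config_le :: "('d::finite) config \<Rightarrow> 'd config \<Rightarrow> bool" where
  "config_le x y \<longleftrightarrow> (\<forall>i. x i \<le> y i)"

definition config_less :: "('d::finite) config \<Rightarrow> 'd config \<Rightarrow> bool" where
  "config_less x y \<longleftrightarrow> config_le x y \<and> x \<noteq> y"

definition birkhoff :: "('d::finite) config \<Rightarrow> bool" where
  "birkhoff x \<longleftrightarrow> (\<forall>k l. config_le x (shift k l x) \<or> config_le (shift k l x) x)"

definition has_rotation_vector :: "('d::finite) config \<Rightarrow> real^'d \<Rightarrow> bool" where
  "has_rotation_vector x \<omega> \<longleftrightarrow>
     (\<forall>i. (\<lambda>n::nat. x (int n *s i) / real n) \<longlonglongrightarrow> (\<Sum>m\<in>UNIV. \<omega> $ m * real_of_int (i $ m)))"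

end

theory Submission
  imports Defs
begin

text \<open>A configuration \<open>x\<close> as in the theorem has oscillation bounded by \<open>\<kappa> \<parallel>m - i\<parallel> + 1\<close>, where
  \<open>\<kappa>\<close> bounds \<open>K\<close>. Hence \<open>\<nabla>W(x)\<close> is bounded, so the flow displaces \<open>x\<close> by at most a constant on
  \<open>[0, t]\<close>, and the local oscillation of \<open>\<Psi>\<^sub>s x\<close> stays bounded; no invariance of Birkhoff
  configurations under the flow is needed. By the lattice symmetries and compactness the
  nearest-neighbour mixed derivatives are at most some \<open>- \<mu> < 0\<close> along the segments from
  \<open>\<Psi>\<^sub>s x\<close> to \<open>\<Psi>\<^sub>s y\<close>. The rescaled difference \<open>v = e\<^bsup>M s\<^esup> (\<Psi>\<^sub>s y - \<Psi>\<^sub>s x)\<close> solves a linear system with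
  nonnegative coefficients, at least \<open>\<mu>\<close> between neighbours, so it stays nonnegative, and
  integrating along a chain of \<open>n\<close> neighbours gives \<open>v\<^sub>i(s) \<ge> (\<mu> s)\<^sup>n / n! v\<^sub>k(0)\<close>.\<close>

section \<open>Geometry of the lattice\<close>

lemma norm1_nonneg [simp]: "0 \<le> norm1 i"
  by (simp add: norm1_def sum_nonneg)

lemma norm1_zero [simp]: "norm1 0 = 0"
  by (simp add: norm1_def)

lemma norm1_minus [simp]: "norm1 (- i) = norm1 i"
  by (simp add: norm1_def)

lemma norm1_commute: "norm1 (i - j) = norm1 (j - i)"
  by (simp add: norm1_def abs_minus_commute)

lemma norm1_add: "norm1 (i + j) \<le> norm1 i + norm1 j"
  unfolding norm1_def by (simp add: sum.distrib [symmetric] sum_mono abs_triangle_ineq)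

lemma norm1_triangle: "norm1 (i - j) \<le> norm1 (i - k) + norm1 (k - j)"
  using norm1_add[of "i - k" "k - j"] by simp

text \<open>A unit step from \<open>i\<close> towards \<open>k\<close>, in a coordinate where they
  differ, lowers the distance by exactly one. Iterated, this is the chain of neighbours along which
  positivity spreads in \<open>Psi_propagation\<close>.\<close>

lemma norm1_step:
  assumes "norm1 (i - k) = int (Suc n)"
  shows "\<exists>m. norm1 (i - m) = 1 \<and> norm1 (m - k) = int n"
proof -
  obtain p where p: "(i - k) $ p \<noteq> 0"
    using assms by (metis norm1_zero of_nat_eq_0_iff nat.distinct(1) vec_eq_iff zero_index)
  define u where "u = sgn ((i - k) $ p)"
  have u: "\<bar>u\<bar> = 1" "\<bar>(i - k) $ p - u\<bar> = \<bar>(i - k) $ p\<bar> - 1"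
    using p unfolding u_def by (auto simp: sgn_if)
  have c: "norm1 (axis p u) = 1"
    unfolding norm1_def axis_def using u by (simp add: if_distrib[of abs] cong: if_cong)
  have "norm1 (i - axis p u - k) = (\<Sum>m\<in>UNIV. \<bar>(i - k) $ m\<bar> - (if m = p then 1 else 0))"
    unfolding norm1_def
    by (rule sum.cong) (use u in \<open>auto simp: axis_def algebra_simps\<close>)
  also have "\<dots> = norm1 (i - k) - 1"
    by (simp add: sum_subtractf norm1_def)
  finally show ?thesis
    using c assms by (intro exI[of _ "i - axis p u"]) simp
qed

lemma lball_mono: "R \<le> R' \<Longrightarrow> lball j R \<subseteq> lball j R'"
  by (auto simp: lball_def)

lemma center_in_lball: "0 \<le> R \<Longrightarrow> j \<in> lball j R"
  by (simp add: lball_def)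

lemma lball_trans:
  assumes "k \<in> lball j R" "j \<in> lball i R'"
  shows "k \<in> lball i (R + R')"
proof -
  have "real_of_int (norm1 (k - i)) \<le> real_of_int (norm1 (k - j)) + real_of_int (norm1 (j - i))"
    using norm1_triangle[of k i j] by linarith
  then show ?thesis using assms by (auto simp: lball_def)
qed

lemma lball_translate: "lball (j + k) R = (\<lambda>i. i + k) ` lball j R"
proof -
  have "i \<in> (\<lambda>i. i + k) ` lball j R" if "i \<in> lball (j + k) R" for i
    using that by (intro image_eqI[of _ _ "i - k"]) (auto simp: lball_def algebra_simps)
  then show ?thesis by (auto simp: lball_def)
qed

section \<open>Finiteness of balls and summability of geometric weights\<close>

lemma finite_int_box: "finite {i::int^'d. \<forall>m. i $ m \<in> {-N..N}}"
proof -
  have "{i::int^'d. \<forall>m. i $ m \<in> {-N..N}} \<subseteq> vec_lambda ` (PiE UNIV (\<lambda>_. {-N..N}))"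
    by (auto intro!: image_eqI[where x="vec_nth _"])
  then show ?thesis
    by (rule finite_subset) (intro finite_imageI finite_PiE; simp)
qed

lemma abs_component_le_norm1: "\<bar>i $ m\<bar> \<le> norm1 i"
  unfolding norm1_def by (rule member_le_sum) auto

lemma finite_lball: "finite (lball (j::int^'d) R)"
proof -
  have "lball (0::int^'d) R \<subseteq> {i. \<forall>m. i $ m \<in> {-\<lfloor>R\<rfloor>..\<lfloor>R\<rfloor>}}"
  proof
    fix i :: "int^'d" assume "i \<in> lball 0 R"
    then have *: "norm1 i \<le> \<lfloor>R\<rfloor>" by (simp add: lball_def le_floor_iff)
    have "\<bar>i $ m\<bar> \<le> \<lfloor>R\<rfloor>" for m
      using order_trans[OF abs_component_le_norm1 *] .
    then have "i $ m \<in> {-\<lfloor>R\<rfloor>..\<lfloor>R\<rfloor>}" for m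
      by (metis abs_le_iff atLeastAtMost_iff minus_le_iff)
    then show "i \<in> {i. \<forall>m. i $ m \<in> {-\<lfloor>R\<rfloor>..\<lfloor>R\<rfloor>}}" by simp
  qed
  then have "finite (lball 0 R :: (int^'d) set)" using finite_int_box finite_subset by blast
  then show ?thesis using lball_translate[of 0 j R] by simp
qed

lemma card_lball: "card (lball (j::int^'d) R) = card (lball (0::int^'d) R)"
proof -
  have "lball j R = (\<lambda>i. i + j) ` lball 0 R" using lball_translate[of 0 j R] by simp
  then show ?thesis by (simp add: card_image)
qed

text \<open>The weight factors over the coordinates, so its sum over a cube is a product of
  one-dimensional geometric sums. Each factor is at most \<open>2 / (1 - q)\<close>, whatever the
  size of the cube.\<close>

lemma summable_power_norm1:
  fixes q :: real
  assumes "0 < q" "q < 1"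
  shows "(\<lambda>i::int^'d. q ^ nat (norm1 i)) summable_on UNIV"
proof (rule nonneg_bdd_above_summable_on)
  show "bdd_above (sum (\<lambda>i::int^'d. q ^ nat (norm1 i)) ` {F. F \<subseteq> UNIV \<and> finite F})"
  proof (rule bdd_aboveI2)
    fix F :: "(int^'d) set" assume "F \<in> {F. F \<subseteq> UNIV \<and> finite F}"
    then have finF: "finite F" by simp
    \<comment> \<open>Any \<open>N\<close> whose cube contains \<open>F\<close> would serve, since
      the final bound is independent of \<open>N\<close>; the sum dominates each of its nonnegative
      terms.\<close>
    define N where "N = (\<Sum>i\<in>F. norm1 i)"
    have "F \<subseteq> {i. \<forall>m. i $ m \<in> {-N..N}}"
    proof clarify
      fix i m assume "i \<in> F"
      then have "norm1 i \<le> N" unfolding N_def using finF by (intro member_le_sum) auto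
      then have "\<bar>i $ m\<bar> \<le> N" using abs_component_le_norm1[of i m] by linarith
      then show "i $ m \<in> {-N..N}" by auto
    qed
    moreover have eq: "q ^ nat (norm1 i) = (\<Prod>m\<in>UNIV. q ^ nat \<bar>i $ m\<bar>)" for i :: "int^'d"
    proof -
      have "nat (norm1 i) = (\<Sum>m\<in>UNIV. nat \<bar>i $ m\<bar>)"
        unfolding norm1_def by (subst nat_eq_iff) (auto simp: sum_nonneg)
      then show ?thesis by (simp add: power_sum)
    qed
    ultimately have "(\<Sum>i\<in>F. q ^ nat (norm1 i))
        \<le> (\<Sum>i | \<forall>m. i $ m \<in> {-N..N}. \<Prod>m\<in>UNIV. q ^ nat \<bar>(i::int^'d) $ m\<bar>)"
      unfolding eq using assms by (intro sum_mono2 finite_int_box prod_nonneg) auto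
    also have "\<dots> = (\<Sum>g\<in>PiE UNIV (\<lambda>_::'d. {-N..N}). \<Prod>m\<in>UNIV. q ^ nat \<bar>g m\<bar>)"
      by (rule sum.reindex_bij_witness[where i=vec_lambda and j=vec_nth]) auto
    also have "\<dots> = (\<Prod>m\<in>(UNIV::'d set). \<Sum>a\<in>{-N..N}. q ^ nat \<bar>a\<bar>)"
      by (subst prod_sum_PiE) auto
    also have "\<dots> \<le> (\<Prod>m\<in>(UNIV::'d set). 2 / (1 - q))"
    proof (rule prod_mono, intro conjI)
      have geo: "(\<Sum>a\<in>{0..N}. q ^ nat a) \<le> 1 / (1 - q)"
      proof -
        have "(\<Sum>a\<in>{0..N}. q ^ nat a) = (\<Sum>n\<in>nat ` {0..N}. q ^ n)"
          by (subst sum.reindex) (auto simp: inj_on_def)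
        also have "\<dots> \<le> (\<Sum>n. q ^ n)"
          using assms by (intro sum_le_suminf summable_geometric) auto
        also have "\<dots> = 1 / (1 - q)" using assms by (intro suminf_geometric) auto
        finally show ?thesis .
      qed
      \<comment> \<open>Two copies of the half-line sum cover the interval; counting
        \<open>0\<close> twice only enlarges the bound.\<close>
      have "(\<Sum>a\<in>{-N..N}. q ^ nat \<bar>a\<bar>) \<le> (\<Sum>a\<in>{0..N} \<union> uminus ` {0..N}. q ^ nat \<bar>a\<bar>)"
      proof (rule sum_mono2)
        show "{-N..N} \<subseteq> {0..N} \<union> uminus ` {0..N}"
        proof
          fix a assume "a \<in> {-N..N}"
          then show "a \<in> {0..N} \<union> uminus ` {0..N}"
            by (cases "0 \<le> a") (auto intro!: image_eqI[of _ _ "-a"])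
        qed
      qed (use assms in auto)
      also have "\<dots> \<le> (\<Sum>a\<in>{0..N}. q ^ nat \<bar>a\<bar>) + (\<Sum>a\<in>uminus ` {0..N}. q ^ nat \<bar>a\<bar>)"
        using assms by (subst sum_Un) (auto simp: sum_nonneg)
      also have "\<dots> = (\<Sum>a\<in>{0..N}. q ^ nat a) + (\<Sum>a\<in>{0..N}. q ^ nat a)"
        by (subst sum.reindex) auto
      finally show "(\<Sum>a\<in>{-N..N}. q ^ nat \<bar>a\<bar>) \<le> 2 / (1 - q)" using geo by simp
      show "0 \<le> (\<Sum>a\<in>{-N..N}. q ^ nat \<bar>a\<bar>)" using assms by (intro sum_nonneg) auto
    qed
    finally show "(\<Sum>i\<in>F. q ^ nat (norm1 i)) \<le> (\<Prod>m\<in>(UNIV::'d set). 2 / (1 - q))" .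
  qed
qed (use assms in auto)

section \<open>Analytic tools\<close>

text \<open>A comparison principle for infinitely many coupled inequalities, where no maximal
  coordinate need exist. The weight \<open>\<rho>\<close> makes the neighbour sum a bounded
  operation, so each integration in time gains a factor and the bounds shrink like
  \<open>(P * q * s) ^ m / fact m\<close>. Only positive parts enter on the right, so a one-sided a
  priori bound starts the iteration.\<close>

lemma linear_system_comparison:
  fixes f f' :: "real \<Rightarrow> 'a \<Rightarrow> real" and \<rho> :: "'a \<Rightarrow> real"
  assumes deriv: "\<And>s i. 0 \<le> s \<Longrightarrow> s \<le> T \<Longrightarrow> ((\<lambda>s. f s i) has_real_derivative f' s i) (at s)"
    and init: "\<And>i. f 0 i \<le> 0"
    and apriori: "\<And>s i. 0 \<le> s \<Longrightarrow> s \<le> T \<Longrightarrow> f s i \<le> A * \<rho> i"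
    and ineq: "\<And>s i. 0 \<le> s \<Longrightarrow> s \<le> T \<Longrightarrow> f' s i \<le> P * (\<Sum>k\<in>B i. max 0 (f s k))"
    and weight: "\<And>i. (\<Sum>k\<in>B i. \<rho> k) \<le> q * \<rho> i"
    and nonneg: "0 \<le> A" "0 \<le> P" "0 \<le> q" "\<And>i. 0 \<le> \<rho> i"
    and s: "0 \<le> s" "s \<le> T"
  shows "f s i \<le> 0"
proof -
  \<comment> \<open>Picard iteration from the a priori bound \<open>f s i \<le> A * \<rho> i\<close>.\<close>
  have iter: "f s i \<le> A * \<rho> i * ((P * q * s) ^ m / fact m)" if "0 \<le> s" "s \<le> T" for m s i
    using that
  proof (induction m arbitrary: s i)
    case 0
    then show ?case using apriori by simp
  next
    case (Suc m)
    \<comment> \<open>The primitive, vanishing at time \<open>0\<close>, of the bound that round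
      \<open>m\<close> gives for the derivative of \<open>f\<close>.\<close>
    define g where "g = (\<lambda>s. A * \<rho> i * ((P * q * s) ^ Suc m / fact (Suc m)))"
    have dg: "(g has_real_derivative P * q * (A * \<rho> i * ((P * q * u) ^ m / fact m))) (at u)" for u
    proof -
      have "((\<lambda>s. (P * q * s) ^ Suc m) has_real_derivative real (Suc m) * (P * q * u) ^ m * (P * q)) (at u)"
        using DERIV_power_Suc[OF DERIV_cmult_Id[of "P * q" u "UNIV"], of m] by (simp add: mult_ac)
      then have "((\<lambda>s. A * \<rho> i * ((P * q * s) ^ Suc m / fact (Suc m))) has_real_derivative
           A * \<rho> i * (real (Suc m) * (P * q * u) ^ m * (P * q) / fact (Suc m))) (at u)"
        by (intro DERIV_cmult DERIV_cdivide)
      moreover have "A * \<rho> i * (real (Suc m) * (P * q * u) ^ m * (P * q) / fact (Suc m))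
          = P * q * (A * \<rho> i * ((P * q * u) ^ m / fact m))"
        by (simp add: fact_Suc divide_simps del: of_nat_Suc power_Suc)
      ultimately show ?thesis unfolding g_def by (simp only:)
    qed
    have "g s - f s i \<ge> g 0 - f 0 i"
    proof (rule DERIV_nonneg_imp_nondecreasing[where f="\<lambda>s. g s - f s i"])
      show "0 \<le> s" by fact
      fix u assume u: "0 \<le> u" "u \<le> s"
      then have uT: "u \<le> T" using Suc by simp
      define e where "e = A * ((P * q * u) ^ m / fact m)"
      have e: "0 \<le> e" unfolding e_def using nonneg u by simp
      have "f' u i \<le> P * (\<Sum>k\<in>B i. max 0 (f u k))" using ineq u uT by blast
      also have "\<dots> \<le> P * (\<Sum>k\<in>B i. e * \<rho> k)"
      proof (intro mult_left_mono sum_mono max.boundedI)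
        fix k
        show "f u k \<le> e * \<rho> k" using Suc.IH[OF u(1) uT, of k] by (simp add: e_def mult_ac)
      qed (use nonneg e in auto)
      also have "\<dots> = P * e * (\<Sum>k\<in>B i. \<rho> k)" by (simp add: sum_distrib_left mult_ac)
      also have "\<dots> \<le> P * e * (q * \<rho> i)" using weight e nonneg by (intro mult_left_mono) auto
      also have "\<dots> = P * q * (A * \<rho> i * ((P * q * u) ^ m / fact m))" by (simp add: e_def mult_ac)
      finally show "\<exists>y. ((\<lambda>s. g s - f s i) has_real_derivative y) (at u) \<and> 0 \<le> y"
        using DERIV_diff[OF dg deriv[OF u(1) uT]] by (intro exI conjI) auto
    qed
    moreover have "g 0 = 0" by (simp add: g_def)
    ultimately show ?case using init[of i] by (simp add: g_def)
  qed
  have "(\<lambda>m. (P * q * s) ^ m / fact m) \<longlonglongrightarrow> 0"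
    using summable_LIMSEQ_zero[OF summable_exp[of "P * q * s"]] by (simp add: field_simps)
  then have "(\<lambda>m. A * \<rho> i * ((P * q * s) ^ m / fact m)) \<longlonglongrightarrow> A * \<rho> i * 0"
    by (rule tendsto_mult_left)
  then show ?thesis
    using iter[OF s, of i] by (intro LIMSEQ_le_const[where X="\<lambda>m. A * \<rho> i * ((P * q * s) ^ m / fact m)"]) auto
qed

section \<open>Partial derivatives and mean values for functions of finitely many
  coordinates\<close>

definition depends_on :: "(int^'d) set \<Rightarrow> ('d config \<Rightarrow> real) \<Rightarrow> bool" where
  "depends_on F f \<longleftrightarrow> (\<forall>x y. (\<forall>k\<in>F. x k = y k) \<longrightarrow> f x = f y)"

lemma depends_onD: "depends_on F f \<Longrightarrow> (\<And>k. k \<in> F \<Longrightarrow> x k = y k) \<Longrightarrow> f x = f y"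
  by (simp add: depends_on_def)

lemma depends_on_mono: "depends_on F f \<Longrightarrow> F \<subseteq> G \<Longrightarrow> depends_on G f"
  unfolding depends_on_def by blast

lemma depends_on_pdiff:
  fixes f :: "('d::finite) config \<Rightarrow> real"
  assumes "depends_on F f"
  shows "depends_on F (pdiff i f)"
  unfolding depends_on_def
proof (intro allI impI)
  fix x y :: "'d config" assume "\<forall>k\<in>F. x k = y k"
  then have "(\<lambda>h. f (x(i := x i + h))) = (\<lambda>h. f (y(i := y i + h)))"
    by (intro ext depends_onD[OF assms]) auto
  then show "pdiff i f x = pdiff i f y" by (simp add: pdiff_def)
qed

lemma pdiff_eq_0:
  assumes "depends_on F f" "i \<notin> F"
  shows "pdiff i f x = 0"
proof -
  have "(\<lambda>h. f (x(i := x i + h))) = (\<lambda>h. f x)"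
    using assms(2) by (intro ext depends_onD[OF assms(1)]) auto
  then show ?thesis by (simp add: pdiff_def)
qed

lemma pdiff_shift: "pdiff i (\<lambda>x. f (shift k l x)) x = pdiff (i - k) f (shift k l x)"
proof -
  have "shift k l (x(i := x i + h)) = (shift k l x)(i - k := shift k l x (i - k) + h)" for h
    by (auto simp: shift_def fun_eq_iff)
  then show ?thesis by (simp add: pdiff_def)
qed

lemma has_derivative_coordinate:
  assumes "pdiff_exists a f"
  shows "((\<lambda>u. f (z(a := u))) has_real_derivative pdiff a f (z(a := u))) (at u)"
proof -
  have "(\<lambda>h. f ((z(a := u))(a := (z(a := u)) a + h))) differentiable (at 0)"
    using assms unfolding pdiff_exists_def by blast
  then have "((\<lambda>h. f (z(a := u + h))) has_real_derivative pdiff a f (z(a := u))) (at 0)"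
    by (auto simp: pdiff_def dest: DERIV_deriv_iff_real_differentiable[THEN iffD2])
  then show ?thesis
    using DERIV_shift[of "\<lambda>u. f (z(a := u))" "pdiff a f (z(a := u))" 0 u] by (simp add: add.commute)
qed

text \<open>Change one coordinate at a time and apply the one-variable mean value theorem to each
  change. The intermediate points vary with \<open>k\<close> and lie in the coordinate box spanned
  by \<open>x\<close> and \<open>y\<close>, in general off the segment.\<close>

lemma mean_value_coordinatewise:
  fixes f :: "('d::finite) config \<Rightarrow> real"
  assumes "finite F" "\<And>a. pdiff_exists a f" "\<And>k. k \<notin> F \<Longrightarrow> x k = y k"
  shows "\<exists>\<xi>. f y - f x = (\<Sum>k\<in>F. pdiff k f (\<xi> k) * (y k - x k)) \<and>
             (\<forall>k m. min (x m) (y m) \<le> \<xi> k m \<and> \<xi> k m \<le> max (x m) (y m))"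
  using assms(1,3)
proof (induction F arbitrary: y)
  case empty
  then have "x = y" by auto
  then show ?case by (intro exI[of _ "\<lambda>_. x"]) auto
next
  case (insert a F)
  \<comment> \<open>The induction hypothesis covers the way from \<open>x\<close> to
    \<open>z\<close>; only coordinate \<open>a\<close> changes from \<open>z\<close> to
    \<open>y\<close>.\<close>
  define z where "z = y(a := x a)"
  have "x k = z k" if "k \<notin> F" for k using insert.prems[of k] that by (auto simp: z_def)
  then obtain \<xi> where xi: "f z - f x = (\<Sum>k\<in>F. pdiff k f (\<xi> k) * (z k - x k))"
      "\<And>k m. min (x m) (z m) \<le> \<xi> k m \<and> \<xi> k m \<le> max (x m) (z m)"
    using insert.IH[of z] by blast
  \<comment> \<open>Parametrising by the unit interval treats both orders of \<open>x a\<close> and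
    \<open>y a\<close>, and equality, in one application of the mean value theorem.\<close>
  define c where "c = (\<lambda>v. x a + v * (y a - x a))"
  have "((\<lambda>v. f (y(a := c v))) has_real_derivative pdiff a f (y(a := c v)) * (y a - x a)) (at v)" for v
    by (rule DERIV_chain2[OF has_derivative_coordinate[OF assms(2)]])
      (auto simp: c_def intro!: derivative_eq_intros)
  then obtain v where v: "0 < v" "v < 1"
      "f (y(a := c 1)) - f (y(a := c 0)) = (1 - 0) * (pdiff a f (y(a := c v)) * (y a - x a))"
    using MVT2[of 0 1 "\<lambda>v. f (y(a := c v))" "\<lambda>v. pdiff a f (y(a := c v)) * (y a - x a)"] by auto
  have c: "min (x a) (y a) \<le> c v \<and> c v \<le> max (x a) (y a)"
  proof (cases "x a \<le> y a")
    case True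
    then have "0 \<le> v * (y a - x a)" "v * (y a - x a) \<le> 1 * (y a - x a)"
      using v by (simp, intro mult_right_mono) auto
    then show ?thesis using True by (simp add: c_def)
  next
    case False
    then have "v * (y a - x a) \<le> 0"
      using v by (intro mult_nonneg_nonpos) auto
    moreover have "y a - x a \<le> v * (y a - x a)"
      using v False mult_right_mono_neg[of v 1 "y a - x a"] by simp
    ultimately have "c v \<le> x a" "y a \<le> c v" unfolding c_def by linarith+
    then show ?thesis using False by auto
  qed
  define \<eta> where "\<eta> = (\<lambda>k. if k = a then y(a := c v) else \<xi> k)"
  have "f y - f x = pdiff a f (\<eta> a) * (y a - x a) + (\<Sum>k\<in>F. pdiff k f (\<xi> k) * (z k - x k))"
    using v(3) xi(1) by (simp add: c_def z_def \<eta>_def)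
  also have "(\<Sum>k\<in>F. pdiff k f (\<xi> k) * (z k - x k)) = (\<Sum>k\<in>F. pdiff k f (\<eta> k) * (y k - x k))"
    using insert.hyps by (intro sum.cong) (auto simp: z_def \<eta>_def)
  finally have "f y - f x = (\<Sum>k\<in>insert a F. pdiff k f (\<eta> k) * (y k - x k))"
    using insert.hyps by simp
  moreover have "min (x m) (y m) \<le> \<eta> k m \<and> \<eta> k m \<le> max (x m) (y m)" for k m
    using xi(2)[of m k] c by (auto simp: \<eta>_def z_def split: if_splits)
  ultimately show ?case by blast
qed

text \<open>Subdividing the segment keeps the intermediate points within distance 1 of it, however
  large \<open>y - x\<close> is; this replaces the chain rule along the segment.\<close>

definition near_segment :: "(int^'d) set \<Rightarrow> 'd config \<Rightarrow> 'd config \<Rightarrow> 'd config \<Rightarrow> bool" where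
  "near_segment F x y \<xi> \<longleftrightarrow>
     (\<exists>\<theta>. 0 \<le> \<theta> \<and> \<theta> \<le> 1 \<and> (\<forall>m\<in>F. \<bar>\<xi> m - (x m + \<theta> * (y m - x m))\<bar> \<le> 1))"

text \<open>Each \<open>c k\<close> is an average of values of \<open>pdiff k f\<close> at points
  near the segment. Stating this through upper and lower bounds lets every uniform estimate of the
  derivative pass to \<open>c k\<close>.\<close>

lemma mean_value_near_segment:
  fixes f :: "('d::finite) config \<Rightarrow> real"
  assumes F: "finite F" "depends_on F f" and ex: "\<And>a. pdiff_exists a f"
  shows "\<exists>c. f y - f x = (\<Sum>k\<in>F. c k * (y k - x k)) \<and>
             (\<forall>k u. (\<forall>\<xi>. near_segment F x y \<xi> \<longrightarrow> pdiff k f \<xi> \<le> u) \<longrightarrow> c k \<le> u) \<and>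
             (\<forall>k u. (\<forall>\<xi>. near_segment F x y \<xi> \<longrightarrow> u \<le> pdiff k f \<xi>) \<longrightarrow> u \<le> c k)"
proof -
  \<comment> \<open>Setting \<open>w\<close> to zero off \<open>F\<close> makes the subdivision
    points differ in finitely many coordinates only; locality of \<open>f\<close> hides the change
    at the endpoint.\<close>
  define w where "w = (\<lambda>k. if k \<in> F then y k - x k else 0)"
  \<comment> \<open>With more pieces than the total displacement, no coordinate moves by more than 1
    in one piece; this is the tolerance in \<open>near_segment\<close>.\<close>
  obtain N :: nat where N: "(\<Sum>k\<in>F. \<bar>w k\<bar>) < N" using reals_Archimedean2 by blast
  have N0: "0 < N" using N sum_nonneg[of F "\<lambda>k. \<bar>w k\<bar>"]
    by (metis abs_ge_zero le_less_trans of_nat_0_less_iff)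
  have wN: "\<bar>w k\<bar> \<le> N" if "k \<in> F" for k
    using member_le_sum[of k F "\<lambda>k. \<bar>w k\<bar>"] that F N by simp
  define z where "z = (\<lambda>n::nat. \<lambda>k. x k + real n / real N * w k)"
  have "\<exists>\<xi>. f (z (Suc n)) - f (z n) = (\<Sum>k\<in>F. pdiff k f (\<xi> k) * (w k / N)) \<and>
            (n < N \<longrightarrow> (\<forall>k. near_segment F x y (\<xi> k)))" for n
  proof -
    have zd: "z (Suc n) k - z n k = w k / N" for k
      using N0 by (simp add: z_def field_simps)
    obtain \<xi> where xi: "f (z (Suc n)) - f (z n) = (\<Sum>k\<in>F. pdiff k f (\<xi> k) * (z (Suc n) k - z n k))"
       "\<And>k m. min (z n m) (z (Suc n) m) \<le> \<xi> k m \<and> \<xi> k m \<le> max (z n m) (z (Suc n) m)"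
      using mean_value_coordinatewise[of F f "z n" "z (Suc n)"] F(1) ex by (auto simp: z_def w_def)
    have "near_segment F x y (\<xi> k)" if "n < N" for k
      unfolding near_segment_def
    proof (intro exI[of _ "real n / real N"] conjI ballI)
      fix m assume m: "m \<in> F"
      have "\<bar>w m / N\<bar> \<le> 1" using wN[OF m] N0 by simp
      moreover have "x m + real n / real N * (y m - x m) = z n m" using m by (simp add: z_def w_def)
      ultimately show "\<bar>\<xi> k m - (x m + real n / real N * (y m - x m))\<bar> \<le> 1"
        using xi(2)[of m k] zd[of m] by (auto simp: abs_if min_def max_def split: if_splits)
    qed (use that in auto)
    then show ?thesis using xi(1) zd by auto
  qed
  then have "\<exists>\<xi>. \<forall>n. f (z (Suc n)) - f (z n) = (\<Sum>k\<in>F. pdiff k f (\<xi> n k) * (w k / N)) \<and>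
            (n < N \<longrightarrow> (\<forall>k. near_segment F x y (\<xi> n k)))"
    by (intro choice allI)
  then obtain \<xi> where xi: "\<And>n. f (z (Suc n)) - f (z n) = (\<Sum>k\<in>F. pdiff k f (\<xi> n k) * (w k / N))"
      "\<And>n k. n < N \<Longrightarrow> near_segment F x y (\<xi> n k)"
    by blast
  define c where "c = (\<lambda>k. (\<Sum>n<N. pdiff k f (\<xi> n k)) / N)"
  have "f y - f x = f (z N) - f (z 0)"
    using N0 by (intro arg_cong2[where f="(-)"] depends_onD[OF F(2)]) (auto simp: z_def w_def)
  also have "\<dots> = (\<Sum>n<N. f (z (Suc n)) - f (z n))"
    using sum_lessThan_telescope[of "\<lambda>n. f (z n)" N] by simp
  also have "\<dots> = (\<Sum>k\<in>F. \<Sum>n<N. pdiff k f (\<xi> n k) * (w k / N))"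
    unfolding xi by (rule sum.swap)
  also have "\<dots> = (\<Sum>k\<in>F. c k * (y k - x k))"
    by (intro sum.cong) (auto simp: c_def w_def sum_distrib_right sum_divide_distrib)
  finally have 1: "f y - f x = (\<Sum>k\<in>F. c k * (y k - x k))" .
  have 2: "c k \<le> u" if "\<forall>\<xi>. near_segment F x y \<xi> \<longrightarrow> pdiff k f \<xi> \<le> u" for k u
  proof -
    have "(\<Sum>n<N. pdiff k f (\<xi> n k)) \<le> (\<Sum>n<N. u)" using that xi(2) by (intro sum_mono) auto
    then show ?thesis using N0 by (simp add: c_def field_simps)
  qed
  have 3: "u \<le> c k" if "\<forall>\<xi>. near_segment F x y \<xi> \<longrightarrow> u \<le> pdiff k f \<xi>" for k u
  proof -
    have "(\<Sum>n<N. u) \<le> (\<Sum>n<N. pdiff k f (\<xi> n k))" using that xi(2) by (intro sum_mono) auto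
    then show ?thesis using N0 by (simp add: c_def field_simps)
  qed
  from 1 2 3 show ?thesis by blast
qed

section \<open>Local potentials\<close>

text \<open>Tychonoff's theorem for the product topology, the one in which \<open>C2_fun\<close>
  demands continuity.\<close>

lemma compact_box: "compact {z::('d::finite) config. \<forall>m. z m \<in> {a..b}}"
proof -
  have "compactin (product_topology (\<lambda>_::int^'d. euclideanreal) UNIV) (PiE UNIV (\<lambda>_. {a..b}))"
    by (simp add: compactin_PiE)
  moreover have "PiE UNIV (\<lambda>_::int^'d. {a..b}) = {z. \<forall>m. z m \<in> {a..b}}" by auto
  ultimately show ?thesis by (simp add: euclidean_product_topology)
qed

locale local_potential =
  fixes S :: "int^('d::finite) \<Rightarrow> 'd config \<Rightarrow> real" and r C :: real
  assumes pot: "local_potentials S r"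
    and C: "\<bar>pdiff i (pdiff k (S j)) x\<bar> \<le> C"
begin

lemma r_pos: "0 < r"
  using pot by (simp add: local_potentials_def)

lemma C_nonneg: "0 \<le> C"
  using C abs_ge_zero order_trans by blast

lemma depends_S: "depends_on (lball j r) (S j)"
  using pot by (simp add: local_potentials_def depends_on_def)

lemma depends_pdiff_S: "depends_on (lball j r) (pdiff i (S j))"
  by (intro depends_on_pdiff depends_S)

lemma C2_S: "C2_fun (S j)"
  using pot by (simp add: local_potentials_def)

lemma pdiff_exists_pdiff: "pdiff_exists k (pdiff i (S j))"
  using C2_S unfolding C2_fun_def by blast

lemma continuous_pdiff2: "continuous_on UNIV (pdiff k (pdiff i (S j)))"
  using C2_S unfolding C2_fun_def by blast

lemma S_shift: "S (j + k) = (\<lambda>x. S j (shift k l x))"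
  using pot by (simp add: local_potentials_def fun_eq_iff)

lemma pdiff_S_shift: "pdiff i (S j) (shift k l x) = pdiff (i + k) (S (j + k)) x"
  unfolding S_shift[of j k l] pdiff_shift by simp

lemma pdiff2_S_shift:
  "pdiff p (pdiff i (S j)) (shift k l x) = pdiff (p + k) (pdiff (i + k) (S (j + k))) x"
proof -
  have "pdiff (i + k) (S (j + k)) = (\<lambda>x. pdiff i (S j) (shift k l x))"
    by (simp add: pdiff_S_shift)
  then show ?thesis by (simp add: pdiff_shift)
qed

lemma gradW_shift: "gradW S r (shift k l x) i = gradW S r x (i + k)"
proof -
  have "gradW S r x (i + k) = (\<Sum>j\<in>(\<lambda>j. j + k) ` lball i r. pdiff (i + k) (S j) x)"
    by (simp add: gradW_def lball_translate)
  also have "\<dots> = gradW S r (shift k l x) i"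
    by (subst sum.reindex) (auto simp: gradW_def pdiff_S_shift)
  finally show ?thesis by simp
qed

lemma gradW_const: "gradW S r (\<lambda>_. real_of_int l) i = gradW S r (\<lambda>_. 0) 0"
  using gradW_shift[of "- i" l "\<lambda>_. 0" i] by (simp add: shift_def)

lemma offdiag: "i \<noteq> k \<Longrightarrow> pdiff i (pdiff k (S j)) x \<le> 0"
  using pot by (simp add: local_potentials_def)

lemma neighbour: "norm1 (i - k) = 1 \<Longrightarrow> pdiff i (pdiff k (S i)) x < 0"
  using pot by (simp add: local_potentials_def)

text \<open>The strict inequality in (D) forces the range to reach nearest neighbours: otherwise
  \<open>S i\<close> would not depend on coordinate \<open>k\<close> and the mixed derivative would
  vanish.\<close>

lemma neighbour_in_lball:
  fixes i :: "int^'d"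
  assumes "norm1 (i - k) = 1"
  shows "k \<in> lball i r"
proof (rule ccontr)
  assume "k \<notin> lball i r"
  then have "pdiff k (S i) = (\<lambda>x. 0)" using pdiff_eq_0[OF depends_S] by auto
  then have "pdiff i (pdiff k (S i)) (\<lambda>_. 0) = 0" by (simp add: pdiff_def)
  then show False using neighbour[OF assms, of "\<lambda>_. 0"] by simp
qed

text \<open>A bound for all second derivatives of the formal sum \<open>W\<close>: an entry in row
  \<open>i\<close> collects the potentials with index in \<open>lball i r\<close>, each contributing
  at most \<open>C\<close>.\<close>

definition M :: real where "M = real (card (lball (0::int^'d) r)) * C"

lemma M_nonneg: "0 \<le> M"
  using C_nonneg by (simp add: M_def)

text \<open>The \<open>a k\<close> are averaged Hessian entries of \<open>W\<close>, summed over the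
  potentials \<open>S j\<close> with \<open>j\<close> within \<open>r\<close> of \<open>i\<close>;
  each of these sees sites within \<open>r\<close> of \<open>j\<close>, hence the radius
  \<open>2 * r\<close>. For a neighbour \<open>k\<close> all summands are nonpositive, so the single
  one with \<open>j = k\<close>, negative by (D), already carries the bound
  \<open>- \<mu>\<close>.\<close>

lemma gradW_mean_value:
  "\<exists>a. gradW S r y i - gradW S r x i = (\<Sum>k\<in>lball i (2 * r). a k * (y k - x k)) \<and>
       (\<forall>k. \<bar>a k\<bar> \<le> M) \<and> (\<forall>k. k \<noteq> i \<longrightarrow> a k \<le> 0) \<and>
       (\<forall>\<mu> k. norm1 (i - k) = 1 \<longrightarrow>
          (\<forall>\<xi>. near_segment (lball i (2 * r)) x y \<xi> \<longrightarrow> pdiff k (pdiff i (S k)) \<xi> \<le> - \<mu>) \<longrightarrow>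
          a k \<le> - \<mu>)"
proof -
  let ?F = "lball i (2 * r)"
  have dep: "depends_on ?F (pdiff i (S j))" if "j \<in> lball i r" for j
  proof (rule depends_on_mono[OF depends_pdiff_S])
    show "lball j r \<subseteq> ?F" unfolding mult_2 using lball_trans[OF _ that] by (intro subsetI)
  qed
  \<comment> \<open>The condition on \<open>j\<close> stays inside the quantifier so that choice
    yields a coefficient function defined for all \<open>j\<close>.\<close>
  have "\<exists>c. j \<in> lball i r \<longrightarrow> pdiff i (S j) y - pdiff i (S j) x = (\<Sum>k\<in>?F. c k * (y k - x k)) \<and>
     (\<forall>k u. (\<forall>\<xi>. near_segment ?F x y \<xi> \<longrightarrow> pdiff k (pdiff i (S j)) \<xi> \<le> u) \<longrightarrow> c k \<le> u) \<and>
     (\<forall>k u. (\<forall>\<xi>. near_segment ?F x y \<xi> \<longrightarrow> u \<le> pdiff k (pdiff i (S j)) \<xi>) \<longrightarrow> u \<le> c k)" for j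
  proof (cases "j \<in> lball i r")
    case True
    show ?thesis
      using mean_value_near_segment[OF finite_lball dep[OF True] pdiff_exists_pdiff, of y x] True by simp
  qed auto
  then have "\<exists>c. \<forall>j. j \<in> lball i r \<longrightarrow> pdiff i (S j) y - pdiff i (S j) x = (\<Sum>k\<in>?F. c j k * (y k - x k)) \<and>
     (\<forall>k u. (\<forall>\<xi>. near_segment ?F x y \<xi> \<longrightarrow> pdiff k (pdiff i (S j)) \<xi> \<le> u) \<longrightarrow> c j k \<le> u) \<and>
     (\<forall>k u. (\<forall>\<xi>. near_segment ?F x y \<xi> \<longrightarrow> u \<le> pdiff k (pdiff i (S j)) \<xi>) \<longrightarrow> u \<le> c j k)"
    by (intro choice allI)
  then obtain c where c: "\<And>j. j \<in> lball i r \<Longrightarrow> pdiff i (S j) y - pdiff i (S j) x = (\<Sum>k\<in>?F. c j k * (y k - x k))"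
     and up: "\<And>j k u. j \<in> lball i r \<Longrightarrow> \<forall>\<xi>. near_segment ?F x y \<xi> \<longrightarrow> pdiff k (pdiff i (S j)) \<xi> \<le> u \<Longrightarrow> c j k \<le> u"
     and lo: "\<And>j k u. j \<in> lball i r \<Longrightarrow> \<forall>\<xi>. near_segment ?F x y \<xi> \<longrightarrow> u \<le> pdiff k (pdiff i (S j)) \<xi> \<Longrightarrow> u \<le> c j k"
    by blast
  define a where "a = (\<lambda>k. \<Sum>j\<in>lball i r. c j k)"
  have "gradW S r y i - gradW S r x i = (\<Sum>j\<in>lball i r. \<Sum>k\<in>?F. c j k * (y k - x k))"
    unfolding gradW_def sum_subtractf[symmetric] by (intro sum.cong refl c)
  also have "\<dots> = (\<Sum>k\<in>?F. a k * (y k - x k))"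
    by (subst sum.swap) (simp add: a_def sum_distrib_right)
  finally have 1: "gradW S r y i - gradW S r x i = (\<Sum>k\<in>?F. a k * (y k - x k))" .
  have cC: "\<bar>c j k\<bar> \<le> C" if "j \<in> lball i r" for j k
  proof -
    have "c j k \<le> C" using C by (intro up that) (auto simp: abs_le_iff)
    moreover have "- C \<le> c j k"
      using C by (intro lo that) (auto simp: abs_le_iff minus_le_iff)
    ultimately show ?thesis by simp
  qed
  have 2: "\<bar>a k\<bar> \<le> M" for k
  proof -
    have "\<bar>a k\<bar> \<le> (\<Sum>j\<in>lball i r. C)" unfolding a_def
      by (rule order_trans[OF sum_abs]) (intro sum_mono cC)
    then show ?thesis by (simp add: M_def card_lball[of i])
  qed
  have c0: "c j k \<le> 0" if "k \<noteq> i" "j \<in> lball i r" for j k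
    using that offdiag by (intro up) auto
  have 3: "a k \<le> 0" if "k \<noteq> i" for k
    unfolding a_def using c0 that by (intro sum_nonpos) auto
  have 4: "a k \<le> - \<mu>" if k: "norm1 (i - k) = 1"
     and l: "\<forall>\<xi>. near_segment ?F x y \<xi> \<longrightarrow> pdiff k (pdiff i (S k)) \<xi> \<le> - \<mu>" for \<mu> k
  proof -
    have ki: "k \<in> lball i r" "k \<noteq> i" using neighbour_in_lball[OF k] k by auto
    have "a k = c k k + (\<Sum>j\<in>lball i r - {k}. c j k)"
      unfolding a_def using ki by (intro sum.remove finite_lball)
    also have "\<dots> \<le> - \<mu> + 0"
      using up[OF ki(1) l] c0[OF ki(2)] by (intro add_mono sum_nonpos) auto
    finally show ?thesis by simp
  qed
  from 1 2 3 4 show ?thesis by blast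
qed

lemma gradW_lipschitz:
  "\<bar>gradW S r y i - gradW S r x i\<bar> \<le> M * (\<Sum>k\<in>lball i (2 * r). \<bar>y k - x k\<bar>)"
proof -
  obtain a where a: "gradW S r y i - gradW S r x i = (\<Sum>k\<in>lball i (2 * r). a k * (y k - x k))"
    "\<And>k. \<bar>a k\<bar> \<le> M"
    using gradW_mean_value[of y i x] by blast
  have "\<bar>gradW S r y i - gradW S r x i\<bar> \<le> (\<Sum>k\<in>lball i (2 * r). \<bar>a k * (y k - x k)\<bar>)"
    unfolding a by (rule sum_abs)
  also have "\<dots> \<le> (\<Sum>k\<in>lball i (2 * r). M * \<bar>y k - x k\<bar>)"
    unfolding abs_mult using a(2) by (intro sum_mono mult_right_mono) auto
  finally show ?thesis by (simp add: sum_distrib_left)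
qed

text \<open>By (B), a lattice translation moves \<open>k\<close> to the origin and an integer shift
  brings \<open>\<xi> k\<close> into the unit interval. By locality the values off the ball can be
  set to zero. What remains is a compact box and finitely many directions \<open>e\<close>, over
  which the negative continuous derivatives have a negative maximum.\<close>

lemma uniform_twist:
  "\<exists>\<mu>>0. \<forall>i k \<xi>. norm1 (i - k) = 1 \<longrightarrow> (\<forall>m\<in>lball k r. \<bar>\<xi> m - \<xi> k\<bar> \<le> E) \<longrightarrow>
     pdiff k (pdiff i (S k)) \<xi> \<le> - \<mu>"
proof -
  \<comment> \<open>The absolute value keeps the box nonempty for every \<open>E\<close>; the extra
    1 leaves room for the fractional part of \<open>\<xi> k\<close>.\<close>
  let ?Z = "{z::'d config. \<forall>m. z m \<in> {-\<bar>E\<bar>..\<bar>E\<bar> + 1}}"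
  let ?U = "{e::int^'d. norm1 e = 1}"
  have "\<exists>\<nu>>0. \<forall>z\<in>?Z. pdiff 0 (pdiff e (S 0)) z \<le> - \<nu>" if "e \<in> ?U" for e
  proof -
    have ne: "?Z \<noteq> {}" by (auto intro!: exI[of _ "\<lambda>_. 0"])
    obtain z where z: "\<And>z'. z' \<in> ?Z \<Longrightarrow> pdiff 0 (pdiff e (S 0)) z' \<le> pdiff 0 (pdiff e (S 0)) z"
      using continuous_attains_sup[OF compact_box ne continuous_on_subset[OF continuous_pdiff2 subset_UNIV], of 0 e 0]
      by blast
    show ?thesis
      using z neighbour[of 0 e z] that by (intro exI[of _ "- pdiff 0 (pdiff e (S 0)) z"]) auto
  qed
  then have "\<exists>\<nu>. \<forall>e\<in>?U. 0 < \<nu> e \<and> (\<forall>z\<in>?Z. pdiff 0 (pdiff e (S 0)) z \<le> - \<nu> e)"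
    by (intro bchoice) auto
  then obtain \<nu> where mu: "\<And>e. e \<in> ?U \<Longrightarrow> 0 < \<nu> e"
     "\<And>e z. e \<in> ?U \<Longrightarrow> z \<in> ?Z \<Longrightarrow> pdiff 0 (pdiff e (S 0)) z \<le> - \<nu> e" by blast
  have finU: "finite ?U"
    by (rule finite_subset[OF _ finite_lball[of 0 1]]) (auto simp: lball_def)
  \<comment> \<open>Inserting 1 makes the minimum range over a nonempty set without exhibiting a
    unit vector.\<close>
  define \<mu> where "\<mu> = Min (insert 1 (\<nu> ` ?U))"
  have lam: "0 < \<mu>" "\<And>e. e \<in> ?U \<Longrightarrow> \<mu> \<le> \<nu> e"
    unfolding \<mu>_def using finU mu(1) by auto
  have "pdiff k (pdiff i (S k)) \<xi> \<le> - \<mu>"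
    if ik: "norm1 (i - k) = 1" and \<xi>: "\<forall>m\<in>lball k r. \<bar>\<xi> m - \<xi> k\<bar> \<le> E" for i k \<xi>
  proof -
    define \<zeta> where "\<zeta> = shift k (- \<lfloor>\<xi> k\<rfloor>) \<xi>"
    define z where "z = (\<lambda>m. if m \<in> lball 0 r then \<zeta> m else 0)"
    have "z m \<in> {-\<bar>E\<bar>..\<bar>E\<bar> + 1}" for m
    proof (cases "m \<in> lball 0 r")
      case True
      then have "m + k \<in> lball k r" by (simp add: lball_def)
      then have *: "\<bar>\<xi> (m + k) - \<xi> k\<bar> \<le> E" using \<xi> by blast
      have "z m = \<xi> (m + k) - \<lfloor>\<xi> k\<rfloor>" using True by (simp add: z_def \<zeta>_def shift_def)
      then have "\<bar>z m - frac (\<xi> k)\<bar> \<le> \<bar>E\<bar>" using * by (simp add: frac_def)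
      then show ?thesis using frac_ge_0[of "\<xi> k"] frac_lt_1[of "\<xi> k"]
        unfolding atLeastAtMost_iff by linarith
    qed (auto simp: z_def)
    then have "z \<in> ?Z" by simp
    moreover have "i - k \<in> ?U" using ik by simp
    ultimately have "pdiff 0 (pdiff (i - k) (S 0)) z \<le> - \<mu>"
      using mu(2)[of "i - k" z] lam(2)[of "i - k"] by linarith
    also have "pdiff 0 (pdiff (i - k) (S 0)) z = pdiff 0 (pdiff (i - k) (S 0)) \<zeta>"
      by (intro depends_onD[OF depends_on_pdiff[OF depends_pdiff_S]]) (simp add: z_def)
    also have "\<dots> = pdiff k (pdiff i (S k)) \<xi>"
      unfolding \<zeta>_def pdiff2_S_shift by simp
    finally show ?thesis .
  qed
  then show ?thesis using lam(1) by blast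
qed

end

section \<open>The space of configurations and Birkhoff configurations\<close>

lemma XspaceI:
  assumes "g summable_on UNIV" "\<And>i. 2 powr (- real_of_int (norm1 i)) * \<bar>x i\<bar> \<le> g i"
  shows "x \<in> Xspace"
  unfolding Xspace_def using assms by (auto intro: summable_on_comparison_test)

lemma powr_norm1: "2 powr (- real_of_int (norm1 i)) = (1 / 2) ^ nat (norm1 i)"
proof -
  have "real_of_int (norm1 i) = real (nat (norm1 i))" by simp
  then show ?thesis by (simp only: powr_minus powr_realpow[of 2] power_one_over inverse_eq_divide)
qed

lemma Xspace_lincomb:
  assumes "x \<in> Xspace" "y \<in> Xspace"
  shows "(\<lambda>i. a * x i + b * y i) \<in> Xspace"
proof (rule XspaceI)
  let ?w = "\<lambda>i. 2 powr (- real_of_int (norm1 i))"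
  show "(\<lambda>i. \<bar>a\<bar> * (?w i * \<bar>x i\<bar>) + \<bar>b\<bar> * (?w i * \<bar>y i\<bar>)) summable_on UNIV"
    using assms unfolding Xspace_def by (intro summable_on_add summable_on_cmult_right) auto
  fix i
  have "\<bar>a * x i + b * y i\<bar> \<le> \<bar>a\<bar> * \<bar>x i\<bar> + \<bar>b\<bar> * \<bar>y i\<bar>"
    by (metis abs_mult abs_triangle_ineq)
  then have "?w i * \<bar>a * x i + b * y i\<bar> \<le> ?w i * (\<bar>a\<bar> * \<bar>x i\<bar> + \<bar>b\<bar> * \<bar>y i\<bar>)"
    by (intro mult_left_mono) auto
  then show "?w i * \<bar>a * x i + b * y i\<bar> \<le> \<bar>a\<bar> * (?w i * \<bar>x i\<bar>) + \<bar>b\<bar> * (?w i * \<bar>y i\<bar>)"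
    by (simp add: algebra_simps)
qed

lemma abs_le_normX:
  assumes "x \<in> Xspace"
  shows "\<bar>x i\<bar> \<le> normX x * 2 powr real_of_int (norm1 i)"
proof -
  let ?f = "\<lambda>i. 2 powr (- real_of_int (norm1 i)) * \<bar>x i\<bar>"
  have "sum ?f {i} \<le> infsum ?f UNIV"
    using assms unfolding Xspace_def by (intro finite_sum_le_infsum) auto
  then have "?f i \<le> normX x" by (simp add: normX_def)
  then have "?f i * 2 powr real_of_int (norm1 i) \<le> normX x * 2 powr real_of_int (norm1 i)"
    by (intro mult_right_mono) auto
  moreover have "?f i * 2 powr real_of_int (norm1 i) = \<bar>x i\<bar>"
    by (simp add: powr_minus)
  ultimately show ?thesis by simp
qed

lemma linear_growth_Xspace:
  fixes x :: "('d::finite) config"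
  assumes "\<And>i. \<bar>x i\<bar> \<le> a + b * real_of_int (norm1 i)" "0 \<le> a" "0 \<le> b"
  shows "x \<in> Xspace"
proof (rule XspaceI)
  show "(\<lambda>i::int^'d. (a + 2 * b) * (3 / 4) ^ nat (norm1 i)) summable_on UNIV"
    by (intro summable_on_cmult_right summable_power_norm1) auto
  fix i :: "int^'d"
  define n where "n = nat (norm1 i)"
  \<comment> \<open>Bernoulli bounds \<open>n\<close> by twice the \<open>n\<close>-th power of 3/2;
    multiplied by the weight 1/2 per step this leaves the ratio 3/4, still summable.\<close>
  have bern: "1 + real n * (1 / 2) \<le> (3 / 2) ^ n"
    using Bernoulli_inequality[of "1 / 2 :: real" n] by simp
  have "\<bar>x i\<bar> \<le> a + b * real n" using assms(1)[of i] by (simp add: n_def)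
  also have "\<dots> \<le> a * (3 / 2) ^ n + b * (2 * (3 / 2) ^ n)"
  proof (intro add_mono)
    have "a * 1 \<le> a * (3 / 2) ^ n" using assms by (intro mult_left_mono) auto
    then show "a \<le> a * (3 / 2) ^ n" by simp
    show "b * real n \<le> b * (2 * (3 / 2) ^ n)" using assms bern by (intro mult_left_mono) auto
  qed
  finally have "(1 / 2) ^ n * \<bar>x i\<bar> \<le> (1 / 2) ^ n * ((a + 2 * b) * (3 / 2) ^ n)"
    by (intro mult_left_mono) (auto simp: algebra_simps)
  also have "\<dots> = (a + 2 * b) * (3 / 4) ^ n"
    by (simp add: power_mult_distrib[symmetric])
  finally show "2 powr (- real_of_int (norm1 i)) * \<bar>x i\<bar> \<le> (a + 2 * b) * (3 / 4) ^ nat (norm1 i)"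
    by (simp add: powr_norm1 n_def)
qed

lemma powr_norm1_lball:
  assumes "k \<in> lball i R"
  shows "2 powr real_of_int (norm1 k) \<le> 2 powr R * 2 powr real_of_int (norm1 i)"
proof -
  have "real_of_int (norm1 k) \<le> R + real_of_int (norm1 i)"
    using norm1_add[of "k - i" i] assms by (simp add: lball_def)
  then show ?thesis by (simp add: powr_add[symmetric])
qed

text \<open>Supplies the weight condition of \<open>linear_system_comparison\<close> for the natural
  growth rate in \<open>Xspace\<close>.\<close>

lemma sum_powr_norm1:
  "(\<Sum>k\<in>lball i R. 2 powr real_of_int (norm1 k))
     \<le> (real (card (lball (0::int^'d) R)) * 2 powr R) * 2 powr real_of_int (norm1 (i::int^'d))"
  using sum_mono[of "lball i R" "\<lambda>k. 2 powr real_of_int (norm1 k)" "\<lambda>_. 2 powr R * 2 powr real_of_int (norm1 i)"]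
    powr_norm1_lball[of _ i R]
  by (simp add: card_lball[of i] mult.assoc)

text \<open>A comparison of \<open>x\<close> with \<open>shift k l x\<close>, iterated along the
  multiples of \<open>k\<close> and divided by \<open>n\<close>, fixes the sign of
  \<open>\<rho> + l\<close>. So for an integer \<open>l\<close> on a known side of
  \<open>- \<rho>\<close> the Birkhoff alternative is decided, and integers within distance 1 of
  \<open>- \<rho>\<close> give the estimate.\<close>

lemma birkhoff_rotation:
  assumes "birkhoff x" "has_rotation_vector x \<omega>"
  shows "\<bar>x (i + k) - x i - (\<Sum>m\<in>UNIV. \<omega> $ m * real_of_int (k $ m))\<bar> \<le> 1"
proof -
  define \<rho> where "\<rho> = (\<Sum>m\<in>UNIV. \<omega> $ m * real_of_int (k $ m))"
  have lim: "(\<lambda>n. x (int n *s k) / real n) \<longlonglongrightarrow> \<rho>"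
    using assms(2) unfolding has_rotation_vector_def \<rho>_def by blast
  have lim0: "(\<lambda>n. x 0 / real n - of_int l) \<longlonglongrightarrow> 0 - of_int l" for l :: int
    by (intro tendsto_diff tendsto_const lim_const_over_n)
  have step: "x (int (Suc n) *s k) = x (int n *s k + k)" for n
    by (rule arg_cong[of _ _ x]) (simp add: vec_eq_iff algebra_simps)
  have up: "\<rho> + of_int l \<ge> 0" if "config_le x (shift k l x)" for l
  proof -
    have it: "x (int n *s k) \<ge> x 0 - real n * of_int l" for n
    proof (induction n)
      case (Suc n)
      have "x (int n *s k) \<le> x (int n *s k + k) + of_int l"
        using that by (simp add: config_le_def shift_def)
      then show ?case unfolding step using Suc by (simp add: algebra_simps)
    qed (simp add: vec_eq_iff)
    have "0 - of_int l \<le> \<rho>"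
    proof (rule LIMSEQ_le[OF lim0 lim], intro exI[of _ 1] allI impI)
      fix n :: nat assume "1 \<le> n"
      then show "x 0 / real n - of_int l \<le> x (int n *s k) / real n"
        using divide_right_mono[OF it[of n], of "real n"] by (simp add: diff_divide_distrib)
    qed
    then show ?thesis by simp
  qed
  have down: "\<rho> + of_int l \<le> 0" if "config_le (shift k l x) x" for l
  proof -
    have it: "x (int n *s k) \<le> x 0 - real n * of_int l" for n
    proof (induction n)
      case (Suc n)
      have "x (int n *s k) \<ge> x (int n *s k + k) + of_int l"
        using that by (simp add: config_le_def shift_def)
      then show ?case unfolding step using Suc by (simp add: algebra_simps)
    qed (simp add: vec_eq_iff)
    have "\<rho> \<le> 0 - of_int l"
    proof (rule LIMSEQ_le[OF lim lim0], intro exI[of _ 1] allI impI)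
      fix n :: nat assume "1 \<le> n"
      then show "x (int n *s k) / real n \<le> x 0 / real n - of_int l"
        using divide_right_mono[OF it[of n], of "real n"] by (simp add: diff_divide_distrib)
    qed
    then show ?thesis by simp
  qed
  \<comment> \<open>The least integer strictly above \<open>- \<rho>\<close>, and below
    \<open>l'\<close> as the greatest one strictly below it: equality would leave the alternative
    undecided.\<close>
  define l where "l = \<lfloor>- \<rho>\<rfloor> + 1"
  have l: "- \<rho> < of_int l" "of_int l \<le> - \<rho> + 1" unfolding l_def by linarith+
  have "config_le x (shift k l x)"
    using assms(1) down[of l] l unfolding birkhoff_def by fastforce
  then have 1: "x i \<le> x (i + k) + of_int l" by (simp add: config_le_def shift_def)
  define l' where "l' = \<lceil>- \<rho>\<rceil> - 1"
  have l': "of_int l' < - \<rho>" "- \<rho> - 1 \<le> of_int l'" unfolding l'_def by linarith+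
  have "config_le (shift k l' x) x"
    using assms(1) up[of l'] l' unfolding birkhoff_def by fastforce
  then have 2: "x (i + k) + of_int l' \<le> x i" by (simp add: config_le_def shift_def)
  show ?thesis using 1 2 l l' unfolding \<rho>_def[symmetric] by linarith
qed

lemma birkhoff_oscillation:
  assumes "birkhoff x" "has_rotation_vector x \<omega>" "norm \<omega> \<le> \<kappa>"
  shows "\<bar>x m - x i\<bar> \<le> \<kappa> * real_of_int (norm1 (m - i)) + 1"
proof -
  have "\<bar>\<Sum>p\<in>UNIV. \<omega> $ p * real_of_int ((m - i) $ p)\<bar> \<le> (\<Sum>p\<in>UNIV. \<kappa> * real_of_int \<bar>(m - i) $ p\<bar>)"
  proof (rule order_trans[OF sum_abs], rule sum_mono)
    fix p
    have "\<bar>\<omega> $ p\<bar> \<le> \<kappa>" using component_le_norm_cart[of \<omega> p] assms(3) by linarith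
    then show "\<bar>\<omega> $ p * real_of_int ((m - i) $ p)\<bar> \<le> \<kappa> * real_of_int \<bar>(m - i) $ p\<bar>"
      by (simp add: abs_mult mult_right_mono del: vector_minus_component)
  qed
  also have "\<dots> = \<kappa> * real_of_int (norm1 (m - i))"
    by (simp add: norm1_def sum_distrib_left)
  finally show ?thesis using birkhoff_rotation[OF assms(1,2), of i "m - i"] by simp
qed

section \<open>Cooperativity of the gradient and its action on \<open>Xspace\<close>\<close>

context local_potential
begin

text \<open>Adding \<open>M\<close> on the diagonal makes all coefficients nonnegative: off the
  diagonal they are \<open>- a k\<close>, on it \<open>M - a i\<close>. In the flow this addition
  comes from the factor \<open>exp (M * s)\<close>.\<close>

lemma cooperative:
  "\<exists>b. M * (y i - x i) - (gradW S r y i - gradW S r x i) = (\<Sum>k\<in>lball i (2 * r). b k * (y k - x k)) \<and>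
       (\<forall>k. 0 \<le> b k \<and> b k \<le> 2 * M) \<and>
       (\<forall>\<mu> k. norm1 (i - k) = 1 \<longrightarrow>
          (\<forall>\<xi>. near_segment (lball i (2 * r)) x y \<xi> \<longrightarrow> pdiff k (pdiff i (S k)) \<xi> \<le> - \<mu>) \<longrightarrow>
          \<mu> \<le> b k)"
proof -
  obtain a where a: "gradW S r y i - gradW S r x i = (\<Sum>k\<in>lball i (2 * r). a k * (y k - x k))"
    "\<And>k. \<bar>a k\<bar> \<le> M" "\<And>k. k \<noteq> i \<Longrightarrow> a k \<le> 0"
    "\<And>\<mu> k. norm1 (i - k) = 1 \<Longrightarrow>
       (\<forall>\<xi>. near_segment (lball i (2 * r)) x y \<xi> \<longrightarrow> pdiff k (pdiff i (S k)) \<xi> \<le> - \<mu>) \<Longrightarrow> a k \<le> - \<mu>"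
    using gradW_mean_value[of y i x] by blast
  define b where "b = (\<lambda>k. (if k = i then M else 0) - a k)"
  have "i \<in> lball i (2 * r)" using r_pos by (intro center_in_lball) simp
  then have "(\<Sum>k\<in>lball i (2 * r). (if k = i then M else 0) * (y k - x k)) = M * (y i - x i)"
    by (subst sum.remove[OF finite_lball, of i]) auto
  then have "M * (y i - x i) - (gradW S r y i - gradW S r x i)
      = (\<Sum>k\<in>lball i (2 * r). b k * (y k - x k))"
    unfolding a(1) b_def by (simp only: left_diff_distrib sum_subtractf)
  moreover have "0 \<le> b k \<and> b k \<le> 2 * M" for k
    using a(2)[of k] a(3)[of k] M_nonneg by (auto simp: b_def abs_le_iff)
  moreover have "\<mu> \<le> b k" if "norm1 (i - k) = 1"
    "\<forall>\<xi>. near_segment (lball i (2 * r)) x y \<xi> \<longrightarrow> pdiff k (pdiff i (S k)) \<xi> \<le> - \<mu>" for \<mu> k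
    using a(4)[OF that] that(1) by (auto simp: b_def)
  ultimately show ?thesis by blast
qed

text \<open>Compare with the zero configuration, whose gradient is the same at every site. The
  Lipschitz bound leaves finitely many translates of \<open>x\<close>, and a translation within the
  window changes the weight by at most the factor \<open>2 powr (2 * r)\<close>.\<close>

lemma gradW_Xspace:
  assumes "x \<in> Xspace"
  shows "gradW S r x \<in> Xspace"
proof (rule XspaceI)
  let ?w = "\<lambda>i::int^'d. 2 powr (- real_of_int (norm1 i))"
  let ?F = "lball (0::int^'d) (2 * r)"
  define g0 where "g0 = \<bar>gradW S r (\<lambda>_. 0) (0::int^'d)\<bar>"
  define g where "g = (\<lambda>i. g0 * ?w i + M * (\<Sum>e\<in>?F. 2 powr (2 * r) * (?w (i + e) * \<bar>x (i + e)\<bar>)))"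
  have shifted: "(\<lambda>i. ?w (i + e) * \<bar>x (i + e)\<bar>) summable_on UNIV" for e
  proof -
    have "bij_betw (\<lambda>i::int^'d. i + e) UNIV UNIV" by (rule bij_betw_byWitness[of _ "\<lambda>i. i - e"]) auto
    from summable_on_reindex_bij_betw[OF this, of "\<lambda>i. ?w i * \<bar>x i\<bar>"] show ?thesis
      using assms by (simp add: Xspace_def)
  qed
  have fin: "(\<lambda>i. \<Sum>e\<in>F. 2 powr (2 * r) * (?w (i + e) * \<bar>x (i + e)\<bar>)) summable_on UNIV"
    if "finite F" for F
    using that by (induction F rule: finite_induct) (auto intro!: summable_on_add summable_on_cmult_right shifted)
  have "?w summable_on UNIV"
    unfolding powr_norm1 by (rule summable_power_norm1) auto
  then show "g summable_on UNIV"
    unfolding g_def by (intro summable_on_add summable_on_cmult_right fin finite_lball)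
  fix i
  have "\<bar>gradW S r x i\<bar> \<le> g0 + M * (\<Sum>k\<in>lball i (2 * r). \<bar>x k\<bar>)"
    using gradW_lipschitz[of x i "\<lambda>_. 0"] gradW_const[of 0 i] by (simp add: g0_def)
  also have "(\<Sum>k\<in>lball i (2 * r). \<bar>x k\<bar>) = (\<Sum>e\<in>?F. \<bar>x (i + e)\<bar>)"
    using lball_translate[of 0 i "2 * r"] by (simp add: sum.reindex add.commute)
  finally have "?w i * \<bar>gradW S r x i\<bar> \<le> ?w i * (g0 + M * (\<Sum>e\<in>?F. \<bar>x (i + e)\<bar>))"
    by (intro mult_left_mono) auto
  also have "\<dots> = g0 * ?w i + M * (\<Sum>e\<in>?F. ?w i * \<bar>x (i + e)\<bar>)"
    by (simp add: algebra_simps sum_distrib_left)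
  also have "\<dots> \<le> g i"
    unfolding g_def
  proof (intro add_mono order_refl mult_left_mono sum_mono M_nonneg)
    fix e assume "e \<in> ?F"
    then have "real_of_int (norm1 (i + e)) \<le> real_of_int (norm1 i) + 2 * r"
      using norm1_add[of i e] by (simp add: lball_def)
    then have "?w i \<le> 2 powr (2 * r) * ?w (i + e)"
      by (simp add: powr_add[symmetric])
    then show "?w i * \<bar>x (i + e)\<bar> \<le> 2 powr (2 * r) * (?w (i + e) * \<bar>x (i + e)\<bar>)"
      by (simp only: mult.assoc[symmetric] mult_right_mono abs_ge_zero)
  qed
  finally show "?w i * \<bar>gradW S r x i\<bar> \<le> g i" .
qed

end

section \<open>The gradient flow\<close>

locale gradient_flow = local_potential S r C
  for S :: "int^('d::finite) \<Rightarrow> 'd config \<Rightarrow> real" and r C :: real +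
  fixes Psi :: "real \<Rightarrow> 'd config \<Rightarrow> 'd config"
  assumes flow: "is_gradient_flow S r Psi"
begin

lemma Psi_Xspace: "x \<in> Xspace \<Longrightarrow> Psi s x \<in> Xspace"
  using flow by (simp add: is_gradient_flow_def)

lemma Psi_0: "x \<in> Xspace \<Longrightarrow> Psi 0 x = x"
  using flow by (simp add: is_gradient_flow_def)

definition defect :: "'d config \<Rightarrow> real \<Rightarrow> real \<Rightarrow> 'd config" where
  "defect x s h = (\<lambda>i. (Psi (s + h) x i - Psi s x i) / h + gradW S r (Psi s x) i)"

lemma defect_tendsto: "x \<in> Xspace \<Longrightarrow> ((\<lambda>h. normX (defect x s h)) \<longlongrightarrow> 0) (at 0)"
  using flow by (simp add: is_gradient_flow_def defect_def)

text \<open>The infinite sum in \<open>normX\<close> takes the default value 0 when it is not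
  summable, so smallness of \<open>normX\<close> controls coordinates only after membership in
  \<open>Xspace\<close> is known; \<open>gradW_Xspace\<close> provides this.\<close>

lemma defect_bound:
  assumes "x \<in> Xspace"
  shows "\<bar>defect x s h i\<bar> \<le> normX (defect x s h) * 2 powr real_of_int (norm1 i)"
proof (rule abs_le_normX)
  have "(\<lambda>i. 1 * (inverse h * Psi (s + h) x i + (- inverse h) * Psi s x i) + 1 * gradW S r (Psi s x) i) \<in> Xspace"
    by (intro Xspace_lincomb Psi_Xspace gradW_Xspace assms)
  then show "defect x s h \<in> Xspace"
    by (simp add: defect_def divide_inverse algebra_simps)
qed

lemma Psi_has_derivative:
  assumes "x \<in> Xspace"
  shows "((\<lambda>s. Psi s x i) has_real_derivative - gradW S r (Psi s x) i) (at s)"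
proof -
  have "((\<lambda>h. normX (defect x s h) * 2 powr real_of_int (norm1 i)) \<longlongrightarrow> 0) (at 0)"
    using defect_tendsto[OF assms] by (rule tendsto_mult_left_zero)
  then have "((\<lambda>h. defect x s h i) \<longlongrightarrow> 0) (at 0)"
    by (rule Lim_null_comparison[rotated]) (use defect_bound[OF assms] in auto)
  then have "((\<lambda>h. defect x s h i - gradW S r (Psi s x) i) \<longlongrightarrow> 0 - gradW S r (Psi s x) i) (at 0)"
    by (intro tendsto_intros)
  then show ?thesis by (simp add: DERIV_def defect_def)
qed

text \<open>Differentiability in \<open>normX\<close> bounds the flow near each single time;
  bisection of the interval then yields one constant for all of it. This starts the iteration in
  \<open>linear_system_comparison\<close>.\<close>

lemma Psi_apriori:
  assumes "x \<in> Xspace" "0 \<le> T"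
  shows "\<exists>A\<ge>0. \<forall>s i. 0 \<le> s \<longrightarrow> s \<le> T \<longrightarrow> \<bar>Psi s x i\<bar> \<le> A * 2 powr real_of_int (norm1 i)"
proof -
  define P where "P = (\<lambda>a b. \<exists>A\<ge>0. \<forall>s i. a \<le> s \<longrightarrow> s \<le> b \<longrightarrow> \<bar>Psi s x i\<bar> \<le> A * 2 powr real_of_int (norm1 i))"
  have "P 0 T"
  proof (rule Bolzano[OF assms(2)])
    fix a b c assume "P a b" "P b c" "a \<le> b" "b \<le> c"
    then obtain A B where A: "0 \<le> A" "\<And>s i. a \<le> s \<Longrightarrow> s \<le> b \<Longrightarrow> \<bar>Psi s x i\<bar> \<le> A * 2 powr real_of_int (norm1 i)"
      and B: "0 \<le> B" "\<And>s i. b \<le> s \<Longrightarrow> s \<le> c \<Longrightarrow> \<bar>Psi s x i\<bar> \<le> B * 2 powr real_of_int (norm1 i)"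
      unfolding P_def by metis
    have "\<bar>Psi s x i\<bar> \<le> (A + B) * 2 powr real_of_int (norm1 i)" if "a \<le> s" "s \<le> c" for s i
    proof (cases "s \<le> b")
      case True
      then have "\<bar>Psi s x i\<bar> \<le> A * 2 powr real_of_int (norm1 i)" using A that by blast
      also have "\<dots> \<le> (A + B) * 2 powr real_of_int (norm1 i)" using B(1) by (intro mult_right_mono) auto
      finally show ?thesis .
    next
      case False
      then have "\<bar>Psi s x i\<bar> \<le> B * 2 powr real_of_int (norm1 i)" using B that by auto
      also have "\<dots> \<le> (A + B) * 2 powr real_of_int (norm1 i)" using A(1) by (intro mult_right_mono) auto
      finally show ?thesis .
    qed
    then show "P a c" unfolding P_def using A(1) B(1) by (intro exI[of _ "A + B"]) auto
  next
    fix s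
    obtain d where d: "0 < d" "\<And>h. h \<noteq> 0 \<Longrightarrow> \<bar>h\<bar> < d \<Longrightarrow> \<bar>normX (defect x s h)\<bar> < 1"
      using LIM_D[OF defect_tendsto[OF assms(1), of s], of 1] by auto
    define g where "g = normX (gradW S r (Psi s x))"
    have nonneg: "0 \<le> normX z" for z :: "'d config" unfolding normX_def by (rule infsum_nonneg) auto
    \<comment> \<open>Within time \<open>d\<close> of \<open>s\<close> the difference quotients are
      at most \<open>1 + g\<close> in the weighted sense: 1 for the defect and \<open>g\<close> for
      the gradient at time \<open>s\<close>.\<close>
    define A where "A = normX (Psi s x) + d * (1 + g)"
    have A0: "0 \<le> A" unfolding A_def g_def using d nonneg by (intro add_nonneg_nonneg mult_nonneg_nonneg) auto
    have bd: "\<bar>Psi u x i\<bar> \<le> A * 2 powr real_of_int (norm1 i)" if "\<bar>u - s\<bar> < d" for u i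
    proof (cases "u = s")
      case True
      have "normX (Psi s x) \<le> A" unfolding A_def g_def using d nonneg by auto
      then have "normX (Psi s x) * 2 powr real_of_int (norm1 i) \<le> A * 2 powr real_of_int (norm1 i)"
        by (intro mult_right_mono) auto
      then show ?thesis using order_trans[OF abs_le_normX[OF Psi_Xspace[OF assms(1)]]] True by simp
    next
      case False
      let ?w = "2 powr real_of_int (norm1 i)"
      define h where "h = u - s"
      have h: "h \<noteq> 0" "\<bar>h\<bar> < d" using False that by (auto simp: h_def)
      have "Psi u x i = Psi s x i + h * (defect x s h i - gradW S r (Psi s x) i)"
        using h by (simp add: defect_def h_def)
      then have "\<bar>Psi u x i\<bar> \<le> \<bar>Psi s x i\<bar> + \<bar>h\<bar> * \<bar>defect x s h i - gradW S r (Psi s x) i\<bar>"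
        by (metis abs_mult abs_triangle_ineq)
      also have "\<dots> \<le> normX (Psi s x) * ?w + d * (1 * ?w + g * ?w)"
      proof (intro add_mono mult_mono)
        show "\<bar>Psi s x i\<bar> \<le> normX (Psi s x) * ?w" by (intro abs_le_normX Psi_Xspace assms)
        have "\<bar>defect x s h i\<bar> \<le> normX (defect x s h) * ?w" by (rule defect_bound[OF assms(1)])
        also have "\<dots> \<le> 1 * ?w" using d(2)[OF h] by (intro mult_right_mono) auto
        finally have "\<bar>defect x s h i\<bar> \<le> 1 * ?w" .
        moreover have "\<bar>gradW S r (Psi s x) i\<bar> \<le> g * ?w"
          unfolding g_def by (intro abs_le_normX gradW_Xspace Psi_Xspace assms)
        ultimately show "\<bar>defect x s h i - gradW S r (Psi s x) i\<bar> \<le> 1 * ?w + g * ?w" by linarith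
      qed (use h d in auto)
      also have "\<dots> = A * ?w" by (simp add: A_def algebra_simps)
      finally show ?thesis .
    qed
    have "P a b" if "a \<le> s" "s \<le> b" "b - a < d" for a b
      unfolding P_def using that by (intro exI[of _ A] conjI A0 allI impI bd) linarith
    then show "\<exists>d>0. \<forall>a b. a \<le> s \<and> s \<le> b \<and> b - a < d \<longrightarrow> P a b" using d(1) by blast
  qed
  then show ?thesis by (simp add: P_def)
qed

text \<open>The right-hand side solves \<open>g' = G + Q * g\<close> with \<open>g 0 = 0\<close> and
  is a supersolution for the displacement in every coordinate. The Lipschitz terms cost
  \<open>M\<close> times the size of the window times \<open>g\<close>; the extra 1 in
  \<open>Q\<close> also makes the division safe.\<close>

lemma Psi_displacement:
  assumes x: "x \<in> Xspace" and G: "\<And>i. \<bar>gradW S r x i\<bar> \<le> G" and s: "0 \<le> s"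
  defines "Q \<equiv> M * real (card (lball (0::int^'d) (2 * r))) + 1"
  shows "\<bar>Psi s x i - x i\<bar> \<le> G / Q * (exp (Q * s) - 1)"
proof -
  let ?B = "\<lambda>i::int^'d. lball i (2 * r)"
  have Q: "1 \<le> Q" using M_nonneg by (simp add: Q_def)
  have G0: "0 \<le> G" using G abs_ge_zero order_trans by blast
  define g where "g = (\<lambda>s. G / Q * (exp (Q * s) - 1))"
  have dg: "(g has_real_derivative G + Q * g u) (at u)" for u
    unfolding g_def using Q by (auto intro!: derivative_eq_intros simp: field_simps)
  have g0: "0 \<le> g u" if "0 \<le> u" for u
    unfolding g_def using that Q G0 by (intro mult_nonneg_nonneg) auto
  \<comment> \<open>The boolean index encodes a sign, so one system on pairs of a site and a sign
    bounds the displacement from above and below at once.\<close>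
  define \<sigma> where "\<sigma> = (\<lambda>b. if b then 1 else - 1 :: real)"
  define f where "f = (\<lambda>u p. \<sigma> (snd p) * (Psi u x (fst p) - x (fst p)) - g u)"
  define f' where "f' = (\<lambda>u p. \<sigma> (snd p) * (- gradW S r (Psi u x) (fst p)) - (G + Q * g u))"
  obtain A where A: "0 \<le> A" "\<And>u i. 0 \<le> u \<Longrightarrow> u \<le> s \<Longrightarrow> \<bar>Psi u x i\<bar> \<le> A * 2 powr real_of_int (norm1 i)"
    using Psi_apriori[OF x s] by blast
  have "f s p \<le> 0" for p
  proof (rule linear_system_comparison[where f=f and s=s and i=p and T=s and A="2 * A" and P=M
        and q="2 * (real (card (lball (0::int^'d) (2 * r))) * 2 powr (2 * r))" and f'=f'
        and \<rho>="\<lambda>p. 2 powr real_of_int (norm1 (fst p))" and B="\<lambda>p. ?B (fst p) \<times> UNIV"])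
    show "((\<lambda>u. f u p) has_real_derivative f' u p) (at u)" for u p
      unfolding f_def f'_def using Psi_has_derivative[OF x, of "fst p" u] dg[of u]
      by (auto intro!: derivative_eq_intros)
    show "f 0 p \<le> 0" for p by (simp add: f_def Psi_0[OF x] g_def)
    show "f u p \<le> 2 * A * 2 powr real_of_int (norm1 (fst p))" if "0 \<le> u" "u \<le> s" for u p
    proof -
      have "\<bar>x (fst p)\<bar> \<le> A * 2 powr real_of_int (norm1 (fst p))"
        using A(2)[of 0 "fst p"] s by (simp add: Psi_0[OF x])
      then show ?thesis using A(2)[OF that, of "fst p"] g0[OF that(1)]
        by (auto simp: f_def \<sigma>_def abs_le_iff)
    qed
    show "f' u p \<le> M * (\<Sum>k\<in>?B (fst p) \<times> UNIV. max 0 (f u k))" if u: "0 \<le> u" "u \<le> s" for u p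
    proof -
      define i where "i = fst p"
      have split: "\<bar>Psi u x k - x k\<bar> \<le> g u + (\<Sum>b\<in>UNIV. max 0 (f u (k, b)))" for k
        by (auto simp: f_def \<sigma>_def UNIV_bool)
      have "f' u p \<le> \<bar>gradW S r (Psi u x) i\<bar> - (G + Q * g u)"
        by (auto simp: f'_def \<sigma>_def i_def)
      also have "\<dots> \<le> \<bar>gradW S r (Psi u x) i - gradW S r x i\<bar> - Q * g u"
        using G[of i] by linarith
      also have "\<dots> \<le> M * (\<Sum>k\<in>?B i. \<bar>Psi u x k - x k\<bar>) - Q * g u"
        using gradW_lipschitz by simp
      also have "\<dots> \<le> M * (\<Sum>k\<in>?B i. g u + (\<Sum>b\<in>UNIV. max 0 (f u (k, b)))) - Q * g u"
        by (intro diff_right_mono mult_left_mono sum_mono split M_nonneg)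
      also have "\<dots> = M * (\<Sum>k\<in>?B i. \<Sum>b\<in>UNIV. max 0 (f u (k, b))) - g u"
        by (simp add: sum.distrib card_lball[of i] Q_def algebra_simps)
      also have "\<dots> \<le> M * (\<Sum>k\<in>?B i. \<Sum>b\<in>UNIV. max 0 (f u (k, b)))"
        using g0[OF u(1)] by simp
      finally show ?thesis by (simp add: sum.cartesian_product i_def)
    qed
    show "(\<Sum>k\<in>?B (fst p) \<times> (UNIV::bool set). 2 powr real_of_int (norm1 (fst k)))
        \<le> 2 * (real (card (lball (0::int^'d) (2 * r))) * 2 powr (2 * r)) * 2 powr real_of_int (norm1 (fst p))" for p
    proof -
      have "(\<Sum>k\<in>?B (fst p) \<times> (UNIV::bool set). 2 powr real_of_int (norm1 (fst k)))
          = 2 * (\<Sum>k\<in>?B (fst p). 2 powr real_of_int (norm1 k))"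
        using sum.cartesian_product[where A="?B (fst p)" and B=UNIV
            and g="\<lambda>k (b::bool). 2 powr real_of_int (norm1 k) :: real"]
        by (simp add: case_prod_beta sum_distrib_left)
      then show ?thesis using sum_powr_norm1[of "fst p" "2 * r"] by simp
    qed
  qed (use A M_nonneg s in auto)
  from this[of "(i, True)"] this[of "(i, False)"] show ?thesis
    by (auto simp: f_def \<sigma>_def g_def)
qed

section \<open>Monotonicity of the flow and its quantitative strengthening\<close>

lemma scaled_difference_derivative:
  assumes "x \<in> Xspace" "y \<in> Xspace"
  shows "((\<lambda>s. exp (M * s) * (Psi s y i - Psi s x i)) has_real_derivative
     exp (M * s) * (M * (Psi s y i - Psi s x i) - (gradW S r (Psi s y) i - gradW S r (Psi s x) i))) (at s)"
  using Psi_has_derivative[OF assms(1), of i s] Psi_has_derivative[OF assms(2), of i s]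
  by (auto intro!: derivative_eq_intros simp: algebra_simps)

text \<open>The comparison principle is applied to the negated rescaled difference: by
  \<open>cooperative\<close> its derivative is a combination of its neighbouring values with
  coefficients between 0 and \<open>2 * M\<close>, hence bounded through their positive
  parts.\<close>

lemma Psi_mono:
  assumes x: "x \<in> Xspace" and y: "y \<in> Xspace" and le: "\<And>i. x i \<le> y i" and s: "0 \<le> s"
  shows "Psi s x i \<le> Psi s y i"
proof -
  obtain A where A: "0 \<le> A" "\<And>u i. 0 \<le> u \<Longrightarrow> u \<le> s \<Longrightarrow> \<bar>Psi u x i\<bar> \<le> A * 2 powr real_of_int (norm1 i)"
    using Psi_apriori[OF x s] by blast
  obtain A' where A': "0 \<le> A'" "\<And>u i. 0 \<le> u \<Longrightarrow> u \<le> s \<Longrightarrow> \<bar>Psi u y i\<bar> \<le> A' * 2 powr real_of_int (norm1 i)"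
    using Psi_apriori[OF y s] by blast
  define v where "v = (\<lambda>s i. exp (M * s) * (Psi s y i - Psi s x i))"
  define v' where "v' = (\<lambda>s i. exp (M * s) * (M * (Psi s y i - Psi s x i) - (gradW S r (Psi s y) i - gradW S r (Psi s x) i)))"
  have "- v s i \<le> 0"
  proof (rule linear_system_comparison[where f="\<lambda>u i. - v u i" and s=s and i=i and T=s
        and A="exp (M * s) * (A + A')" and P="2 * M" and f'="\<lambda>u i. - v' u i"
        and q="real (card (lball (0::int^'d) (2 * r))) * 2 powr (2 * r)"
        and \<rho>="\<lambda>i. 2 powr real_of_int (norm1 i)" and B="\<lambda>i. lball i (2 * r)"])
    show "((\<lambda>u. - v u i) has_real_derivative - v' u i) (at u)" for u i
      unfolding v_def v'_def by (intro DERIV_minus scaled_difference_derivative x y)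
    show "- v 0 i \<le> 0" for i using le[of i] by (simp add: v_def Psi_0 x y)
    show "- v u i \<le> exp (M * s) * (A + A') * 2 powr real_of_int (norm1 i)" if u: "0 \<le> u" "u \<le> s" for u i
    proof -
      have "- v u i = exp (M * u) * (Psi u x i - Psi u y i)" by (simp add: v_def algebra_simps)
      also have "\<dots> \<le> exp (M * u) * ((A + A') * 2 powr real_of_int (norm1 i))"
        using A(2)[OF u, of i] A'(2)[OF u, of i] by (intro mult_left_mono) (auto simp: algebra_simps)
      also have "\<dots> \<le> exp (M * s) * ((A + A') * 2 powr real_of_int (norm1 i))"
        using A(1) A'(1) M_nonneg u by (intro mult_right_mono) (auto intro: mult_left_mono)
      finally show ?thesis by (simp add: mult.assoc)
    qed
    show "- v' u i \<le> 2 * M * (\<Sum>k\<in>lball i (2 * r). max 0 (- v u k))" for u i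
    proof -
      obtain b where b: "M * (Psi u y i - Psi u x i) - (gradW S r (Psi u y) i - gradW S r (Psi u x) i)
          = (\<Sum>k\<in>lball i (2 * r). b k * (Psi u y k - Psi u x k))" "\<And>k. 0 \<le> b k \<and> b k \<le> 2 * M"
        using cooperative[of "Psi u y" i "Psi u x"] by blast
      have "- v' u i = (\<Sum>k\<in>lball i (2 * r). b k * (- v u k))"
        unfolding v'_def b v_def by (simp add: sum_distrib_left sum_negf[symmetric] mult_ac)
      also have "\<dots> \<le> (\<Sum>k\<in>lball i (2 * r). (2 * M) * max 0 (- v u k))"
      proof (rule sum_mono)
        fix k
        have "b k * (- v u k) \<le> b k * max 0 (- v u k)" using b(2) by (intro mult_left_mono) auto
        also have "\<dots> \<le> (2 * M) * max 0 (- v u k)" using b(2) by (intro mult_right_mono) auto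
        finally show "b k * (- v u k) \<le> (2 * M) * max 0 (- v u k)" .
      qed
      finally show ?thesis by (simp add: sum_distrib_left)
    qed
    show "(\<Sum>k\<in>lball i (2 * r). 2 powr real_of_int (norm1 k))
      \<le> real (card (lball (0::int^'d) (2 * r))) * 2 powr (2 * r) * 2 powr real_of_int (norm1 i)" for i :: "int^'d"
      by (rule sum_powr_norm1)
  qed (use A A' M_nonneg s in auto)
  then show ?thesis by (simp add: v_def zero_le_mult_iff)
qed

text \<open>Induction on the distance \<open>n\<close>. For a neighbour \<open>m\<close> of
  \<open>i\<close> one step closer to \<open>k\<close>, the derivative of \<open>v\<close> at
  \<open>i\<close> is at least \<open>\<mu> * v u m\<close>; integrating the bound for
  \<open>m\<close> over all earlier times \<open>u\<close> raises the power of
  \<open>\<mu> * s\<close> by one and produces the factorial.\<close>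

lemma Psi_propagation:
  assumes x: "x \<in> Xspace" and y: "y \<in> Xspace" and le: "\<And>i. x i \<le> y i" and \<mu>: "0 \<le> \<mu>"
    and twist: "\<And>s i k \<xi>. 0 \<le> s \<Longrightarrow> s \<le> T \<Longrightarrow> norm1 (i - k) = 1 \<Longrightarrow>
        near_segment (lball i (2 * r)) (Psi s x) (Psi s y) \<xi> \<Longrightarrow> pdiff k (pdiff i (S k)) \<xi> \<le> - \<mu>"
    and s: "0 \<le> s" "s \<le> T" and ik: "norm1 (i - k) = int n"
  shows "(\<mu> * s) ^ n / fact n * (y k - x k) \<le> exp (M * s) * (Psi s y i - Psi s x i)"
proof -
  define v where "v = (\<lambda>s i. exp (M * s) * (Psi s y i - Psi s x i))"
  define v' where "v' = (\<lambda>s i. exp (M * s) * (M * (Psi s y i - Psi s x i) - (gradW S r (Psi s y) i - gradW S r (Psi s x) i)))"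
  have dv: "((\<lambda>u. v u i) has_real_derivative v' u i) (at u)" for u i
    unfolding v_def v'_def by (intro scaled_difference_derivative x y)
  have v0: "v 0 i = y i - x i" for i by (simp add: v_def Psi_0 x y)
  have vpos: "0 \<le> v u i" if "0 \<le> u" for u i
    using Psi_mono[OF x y le that, of i] by (simp add: v_def)
  have v'1: "0 \<le> v' u i" and v'2: "\<And>m. norm1 (i - m) = 1 \<Longrightarrow> \<mu> * v u m \<le> v' u i" if u: "0 \<le> u" "u \<le> T" for u i
  proof -
    let ?B = "lball i (2 * r)"
    obtain b where b: "M * (Psi u y i - Psi u x i) - (gradW S r (Psi u y) i - gradW S r (Psi u x) i)
        = (\<Sum>k\<in>?B. b k * (Psi u y k - Psi u x k))" "\<And>k. 0 \<le> b k"
        "\<And>k. norm1 (i - k) = 1 \<Longrightarrow> \<mu> \<le> b k"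
      using cooperative[of "Psi u y" i "Psi u x"] twist[OF u, of i] by blast
    have v': "v' u i = (\<Sum>k\<in>?B. b k * v u k)"
      unfolding v'_def b v_def by (simp add: sum_distrib_left mult_ac)
    have nn: "0 \<le> b k * v u k" for k using b(2) vpos[OF u(1)] by simp
    show "0 \<le> v' u i" unfolding v' by (intro sum_nonneg nn)
    show "\<mu> * v u m \<le> v' u i" if m: "norm1 (i - m) = 1" for m
    proof -
      have "m \<in> ?B" using neighbour_in_lball[OF m] lball_mono[of r "2 * r" i] r_pos by auto
      then have "b m * v u m \<le> v' u i" unfolding v' by (intro member_le_sum nn finite_lball)
      moreover have "\<mu> * v u m \<le> b m * v u m" using b(3)[OF m] vpos[OF u(1)] by (intro mult_right_mono)
      ultimately show ?thesis by linarith
    qed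
  qed
  have "(\<mu> * s) ^ n / fact n * (y k - x k) \<le> v s i"
    using ik s
  proof (induction n arbitrary: s i)
    case 0
    then have "i - k = 0" using abs_component_le_norm1[of "i - k"] by (auto simp: vec_eq_iff)
    \<comment> \<open>At distance zero the claim is that \<open>v\<close> does not decrease, since
      its derivative is a sum of nonnegative terms.\<close>
    moreover have "v 0 i \<le> v s i"
    proof (rule DERIV_nonneg_imp_nondecreasing[where f="\<lambda>u. v u i"])
      show "0 \<le> s" by (rule 0)
      fix u assume "0 \<le> u" "u \<le> s"
      then show "\<exists>d. ((\<lambda>u. v u i) has_real_derivative d) (at u) \<and> 0 \<le> d"
        using dv v'1[of u i] 0 by (intro exI[of _ "v' u i"]) auto
    qed
    ultimately show ?case by (simp add: v0)
  next
    case (Suc n)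
    obtain m where m: "norm1 (i - m) = 1" "norm1 (m - k) = int n" using norm1_step Suc.prems(1) by blast
    define g where "g = (\<lambda>u. (\<mu> * u) ^ Suc n / fact (Suc n) * (y k - x k))"
    have dg: "(g has_real_derivative \<mu> * ((\<mu> * u) ^ n / fact n * (y k - x k))) (at u)" for u
    proof -
      have "((\<lambda>u. (\<mu> * u) ^ Suc n) has_real_derivative real (Suc n) * (\<mu> * u) ^ n * \<mu>) (at u)"
        using DERIV_power_Suc[OF DERIV_cmult_Id[of \<mu> u "UNIV"], of n] by (simp add: mult_ac)
      then have "(g has_real_derivative real (Suc n) * (\<mu> * u) ^ n * \<mu> / fact (Suc n) * (y k - x k)) (at u)"
        unfolding g_def by (intro DERIV_cmult_right DERIV_cdivide)
      moreover have "real (Suc n) * (\<mu> * u) ^ n * \<mu> / fact (Suc n) * (y k - x k)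
          = \<mu> * ((\<mu> * u) ^ n / fact n * (y k - x k))"
        by (simp add: fact_Suc divide_simps del: of_nat_Suc power_Suc)
      ultimately show ?thesis by (simp only:)
    qed
    have "v 0 i - g 0 \<le> v s i - g s"
    proof (rule DERIV_nonneg_imp_nondecreasing[where f="\<lambda>u. v u i - g u"])
      show "0 \<le> s" by (rule Suc)
      fix u assume u: "0 \<le> u" "u \<le> s"
      then have uT: "u \<le> T" using Suc by simp
      have "\<mu> * ((\<mu> * u) ^ n / fact n * (y k - x k)) \<le> \<mu> * v u m"
        by (intro mult_left_mono \<mu> Suc.IH m u uT)
      also have "\<dots> \<le> v' u i" by (intro v'2 u uT m)
      finally show "\<exists>d. ((\<lambda>u. v u i - g u) has_real_derivative d) (at u) \<and> 0 \<le> d"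
        using DERIV_diff[OF dv dg, of i u] by (intro exI conjI) auto
    qed
    moreover have "g 0 = 0" by (simp add: g_def)
    ultimately show ?case using vpos[of 0 i] by (simp add: g_def)
  qed
  then show ?thesis by (simp add: v_def)
qed

text \<open>The reference is the constant configuration with value the floor of \<open>x i\<close>:
  being an integer shift of zero, it has the same gradient as zero, so the bound does not see the
  size of \<open>x\<close>. The 2 adds the rounding error to the oscillation constant 1.\<close>

lemma gradW_bounded_of_oscillation:
  assumes osc: "\<And>m i. \<bar>x m - x i\<bar> \<le> \<kappa> * real_of_int (norm1 (m - i)) + 1" and \<kappa>: "0 \<le> \<kappa>"
  shows "\<bar>gradW S r x i\<bar> \<le> \<bar>gradW S r (\<lambda>_. 0) 0\<bar>
     + M * (real (card (lball (0::int^'d) (2 * r))) * (\<kappa> * (2 * r) + 2))"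
proof -
  have "\<bar>gradW S r x i - gradW S r (\<lambda>_. 0) 0\<bar> \<le> M * (\<Sum>k\<in>lball i (2 * r). \<bar>x k - \<lfloor>x i\<rfloor>\<bar>)"
    using gradW_lipschitz[of x i "\<lambda>_. real_of_int \<lfloor>x i\<rfloor>"] unfolding gradW_const .
  also have "\<dots> \<le> M * (\<Sum>k\<in>lball i (2 * r). \<kappa> * (2 * r) + 2)"
  proof (intro mult_left_mono sum_mono M_nonneg)
    fix k assume "k \<in> lball i (2 * r)"
    then have "\<kappa> * real_of_int (norm1 (k - i)) \<le> \<kappa> * (2 * r)"
      using \<kappa> by (intro mult_left_mono) (auto simp: lball_def)
    then have "\<bar>x k - x i\<bar> \<le> \<kappa> * (2 * r) + 1" using osc[of k i] by linarith
    then show "\<bar>x k - \<lfloor>x i\<rfloor>\<bar> \<le> \<kappa> * (2 * r) + 2" by linarith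
  qed
  also have "\<dots> = M * (real (card (lball (0::int^'d) (2 * r))) * (\<kappa> * (2 * r) + 2))"
    by (simp add: card_lball[of i])
  finally show ?thesis by linarith
qed

text \<open>The point is the order of quantifiers: \<open>\<mu>\<close> is fixed by
  \<open>\<kappa>\<close>, \<open>t\<close> and the potentials before \<open>x\<close> and
  \<open>y\<close> appear.\<close>

lemma uniform_propagation:
  assumes t: "0 < t" and \<kappa>: "0 \<le> \<kappa>"
  shows "\<exists>\<mu>>0. \<forall>x y. (\<forall>m i. \<bar>x m - x i\<bar> \<le> \<kappa> * real_of_int (norm1 (m - i)) + 1) \<and>
      (\<forall>m i. \<bar>y m - y i\<bar> \<le> \<kappa> * real_of_int (norm1 (m - i)) + 1) \<and> (\<forall>i. x i \<le> y i) \<longrightarrow>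
      (\<forall>n i k. norm1 (i - k) = int n \<longrightarrow>
        (\<mu> * t) ^ n / fact n * (y k - x k) \<le> exp (M * t) * (Psi t y i - Psi t x i))"
proof -
  define G where "G = \<bar>gradW S r (\<lambda>_. 0) 0\<bar>
     + M * (real (card (lball (0::int^'d) (2 * r))) * (\<kappa> * (2 * r) + 2))"
  define Q where "Q = M * real (card (lball (0::int^'d) (2 * r))) + 1"
  define D where "D = G / Q * (exp (Q * t) - 1)"
  \<comment> \<open>\<open>2 * D\<close> for the displacement at two sites,
    \<open>\<kappa> * r + 1\<close> for the initial oscillation over a ball, and 2 for the tolerance
    of \<open>near_segment\<close> at both sites.\<close>
  define E where "E = 2 * D + \<kappa> * r + 3"
  have Q: "1 \<le> Q" using M_nonneg by (simp add: Q_def)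
  have G: "0 \<le> G" unfolding G_def using M_nonneg \<kappa> r_pos by simp
  obtain \<mu> where mu: "0 < \<mu>" "\<And>i k \<xi>. norm1 (i - k) = 1 \<Longrightarrow> (\<forall>m\<in>lball k r. \<bar>\<xi> m - \<xi> k\<bar> \<le> E) \<Longrightarrow>
     pdiff k (pdiff i (S k)) \<xi> \<le> - \<mu>"
    using uniform_twist[of E] by blast
  have X: "x \<in> Xspace" if "\<And>m i. \<bar>x m - x i\<bar> \<le> \<kappa> * real_of_int (norm1 (m - i)) + 1" for x :: "'d config"
  proof (rule linear_growth_Xspace)
    show "\<bar>x i\<bar> \<le> (\<bar>x 0\<bar> + 1) + \<kappa> * real_of_int (norm1 i)" for i using that[of i 0] by simp
  qed (use \<kappa> in auto)
  have osc: "\<bar>Psi s x m - Psi s x k\<bar> \<le> 2 * D + \<kappa> * r + 1"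
    if x: "\<And>m i. \<bar>x m - x i\<bar> \<le> \<kappa> * real_of_int (norm1 (m - i)) + 1"
      and s: "0 \<le> s" "s \<le> t" and m: "m \<in> lball k r" for x s m k
  proof -
    have disp: "\<bar>Psi s x j - x j\<bar> \<le> D" for j
    proof -
      have "\<bar>Psi s x j - x j\<bar> \<le> G / Q * (exp (Q * s) - 1)"
        unfolding Q_def by (intro Psi_displacement X x s) (auto simp: G_def intro!: gradW_bounded_of_oscillation x \<kappa>)
      also have "\<dots> \<le> D"
        unfolding D_def using Q G s by (intro mult_left_mono) auto
      finally show ?thesis .
    qed
    have "\<kappa> * real_of_int (norm1 (m - k)) \<le> \<kappa> * r"
      using m \<kappa> by (intro mult_left_mono) (auto simp: lball_def)
    then show ?thesis using x[of m k] disp[of m] disp[of k] by linarith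
  qed
  have main: "(\<mu> * t) ^ n / fact n * (y k - x k) \<le> exp (M * t) * (Psi t y i - Psi t x i)"
    if x: "\<And>m i. \<bar>x m - x i\<bar> \<le> \<kappa> * real_of_int (norm1 (m - i)) + 1"
      and y: "\<And>m i. \<bar>y m - y i\<bar> \<le> \<kappa> * real_of_int (norm1 (m - i)) + 1"
      and le: "\<And>i. x i \<le> y i" and ik: "norm1 (i - k) = int n" for x y n i k
  proof (rule Psi_propagation[OF X[OF x] X[OF y] le _ _ _ order_refl ik])
    fix s i k \<xi> assume s: "0 \<le> s" "s \<le> t" and ik: "norm1 (i - k) = 1"
      and near: "near_segment (lball i (2 * r)) (Psi s x) (Psi s y) \<xi>"
    obtain \<theta> where th: "0 \<le> \<theta>" "\<theta> \<le> 1"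
      "\<And>m. m \<in> lball i (2 * r) \<Longrightarrow> \<bar>\<xi> m - (Psi s x m + \<theta> * (Psi s y m - Psi s x m))\<bar> \<le> 1"
      using near unfolding near_segment_def by blast
    have ki: "k \<in> lball i r" by (rule neighbour_in_lball[OF ik])
    have "\<bar>\<xi> m - \<xi> k\<bar> \<le> E" if m: "m \<in> lball k r" for m
    proof -
      have mi: "m \<in> lball i (2 * r)" unfolding mult_2 by (rule lball_trans[OF m ki])
      have ki2: "k \<in> lball i (2 * r)" using ki lball_mono[of r "2 * r" i] r_pos by auto
      let ?a = "Psi s x m - Psi s x k" and ?b = "Psi s y m - Psi s y k"
      let ?e = "2 * D + \<kappa> * r + 1"
      \<comment> \<open>Oscillation is convex along the segment, so it stays bounded even when
        \<open>x\<close> and \<open>y\<close> are far apart.\<close>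
      have "\<bar>(1 - \<theta>) * ?a + \<theta> * ?b\<bar> \<le> (1 - \<theta>) * \<bar>?a\<bar> + \<theta> * \<bar>?b\<bar>"
        using th abs_triangle_ineq[of "(1 - \<theta>) * ?a" "\<theta> * ?b"] by (simp add: abs_mult)
      also have "\<dots> \<le> (1 - \<theta>) * ?e + \<theta> * ?e"
        using th by (intro add_mono mult_left_mono osc[OF x s m] osc[OF y s m]) auto
      also have "\<dots> = ?e" by (simp add: algebra_simps)
      finally have "\<bar>(1 - \<theta>) * ?a + \<theta> * ?b\<bar> \<le> ?e" .
      moreover have "(1 - \<theta>) * ?a + \<theta> * ?b = (Psi s x m + \<theta> * (Psi s y m - Psi s x m))
          - (Psi s x k + \<theta> * (Psi s y k - Psi s x k))" by (simp add: algebra_simps)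
      ultimately show ?thesis using th(3)[OF mi] th(3)[OF ki2] unfolding E_def by linarith
    qed
    then show "pdiff k (pdiff i (S k)) \<xi> \<le> - \<mu>" using mu(2)[OF ik] by blast
  qed (use mu t in auto)
  then show ?thesis using mu(1) by blast
qed

end

theorem mainTheorem13:
  fixes S :: "int^'d \<Rightarrow> 'd config \<Rightarrow> real"
    and r :: real
    and Psi :: "real \<Rightarrow> 'd config \<Rightarrow> 'd config"
    and t :: real
    and K :: "(real^'d) set"
  assumes "local_potentials S r"
    and "is_gradient_flow S r Psi"
    and "0 < t"
    and "compact K"
  shows "\<forall>n::nat. \<exists>L>0. \<forall>x y.
           birkhoff x \<and> birkhoff y \<and> config_less x y \<and>
           (\<exists>\<omega>\<in>K. has_rotation_vector x \<omega>) \<and> (\<exists>\<omega>\<in>K. has_rotation_vector y \<omega>) \<longrightarrow>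
           (\<forall>i k. norm1 (i - k) = int n \<longrightarrow> Psi t y i - Psi t x i \<ge> L * (y k - x k))"
proof
  fix n :: nat
  have "\<exists>C. \<forall>i k j x. \<bar>pdiff i (pdiff k (S j)) x\<bar> \<le> C"
    using assms(1) by (simp add: local_potentials_def)
  then obtain C where "\<And>i k j x. \<bar>pdiff i (pdiff k (S j)) x\<bar> \<le> C" by blast
  then interpret gradient_flow S r C Psi
    using assms(1,2) by unfold_locales
  obtain \<kappa> where \<kappa>: "0 < \<kappa>" "\<And>\<omega>. \<omega> \<in> K \<Longrightarrow> norm \<omega> \<le> \<kappa>"
    using compact_imp_bounded[OF assms(4)] unfolding bounded_pos by blast
  obtain \<mu> where mu: "0 < \<mu>" "\<And>x y n i k. (\<forall>m i. \<bar>x m - x i\<bar> \<le> \<kappa> * real_of_int (norm1 (m - i)) + 1) \<Longrightarrow>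
      (\<forall>m i. \<bar>y m - y i\<bar> \<le> \<kappa> * real_of_int (norm1 (m - i)) + 1) \<Longrightarrow> (\<forall>i. x i \<le> y i) \<Longrightarrow>
      norm1 (i - k) = int n \<Longrightarrow>
      (\<mu> * t) ^ n / fact n * (y k - x k) \<le> exp (M * t) * (Psi t y i - Psi t x i)"
    using uniform_propagation[OF assms(3), of \<kappa>] \<kappa>(1) by auto
  \<comment> \<open>The exponential undoes the rescaling by \<open>exp (M * t)\<close>; the set
    \<open>K\<close> enters only through \<open>\<kappa>\<close>, on which \<open>\<mu>\<close>
    depends.\<close>
  define L where "L = (\<mu> * t) ^ n / fact n * exp (- (M * t))"
  have "0 < L" unfolding L_def using mu(1) assms(3) by simp
  moreover have "L * (y k - x k) \<le> Psi t y i - Psi t x i"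
    if xy: "birkhoff x" "birkhoff y" "config_less x y" "\<omega> \<in> K" "has_rotation_vector x \<omega>"
       "\<omega>' \<in> K" "has_rotation_vector y \<omega>'" and ik: "norm1 (i - k) = int n" for x y \<omega> \<omega>' i k
  proof -
    have "(\<mu> * t) ^ n / fact n * (y k - x k) \<le> exp (M * t) * (Psi t y i - Psi t x i)"
      using xy \<kappa>(2) by (intro mu(2) ik allI birkhoff_oscillation) (auto simp: config_less_def config_le_def)
    then have "exp (- (M * t)) * ((\<mu> * t) ^ n / fact n * (y k - x k))
        \<le> exp (- (M * t)) * (exp (M * t) * (Psi t y i - Psi t x i))"
      by (intro mult_left_mono) auto
    moreover have "exp (- (M * t)) * (exp (M * t) * z) = z" for z :: real
      by (simp add: mult.assoc[symmetric] exp_add[symmetric])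
    ultimately have "exp (- (M * t)) * ((\<mu> * t) ^ n / fact n * (y k - x k)) \<le> Psi t y i - Psi t x i"
      by (simp only:)
    then show ?thesis by (simp only: L_def mult_ac)
  qed
  ultimately show "\<exists>L>0. \<forall>x y.
           birkhoff x \<and> birkhoff y \<and> config_less x y \<and>
           (\<exists>\<omega>\<in>K. has_rotation_vector x \<omega>) \<and> (\<exists>\<omega>\<in>K. has_rotation_vector y \<omega>) \<longrightarrow>
           (\<forall>i k. norm1 (i - k) = int n \<longrightarrow> Psi t y i - Psi t x i \<ge> L * (y k - x k))"
    by blast
qed

end
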